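(* Let $n,d\ge 1$ be integers, let $C\subset\mathbb{R}^{n+d}$ be a convex body, let $S=C\cap(\mathbb{Z}^n\times\mathbb{R}^d)$, and let $K=\operatorname{proj}_{\mathbb{R}^n}(C)\subset\mathbb{R}^n$. Assume that there exist $z_0\in\mathbb{R}^n$ and $k>0$ such that $$z_0+k\,\mathbb{B}_\infty^n\subseteq K,\qquad k\ge \frac{3e}{2}(n+d).$$ Then there exists $y^\star\in S$ such that for every closed halfspace $H\subseteq\mathbb{R}^{n+d}$ with $y^\star\in H$, $$\mathcal{H}_d(S\cap H)\ \ge\ \Bigl(\frac1e-\frac{3(n+d)}{2k}\Bigr)\mathcal{H}_d(S).$$
   Context: A convex body is a compact convex set with nonempty interior. Points of $\mathbb{R}^{n+d}=\mathbb{R}^n\times\mathbb{R}^d$ are written $(z,x)$, and $\operatorname{proj}_{\mathbb{R}^n}(z,x)=z$; the projection of a set is its image. $\mathbb{B}_\infty^n=\{u\in\mathbb{R}^n:\|u\|_\infty\le 1\}$. For a measurable set $A\subseteq\mathbb{Z}^n\times\mathbb{R}^d$, the mixed-integer volume is $\mathcal{H}_d(A)=\sum_{z\in\mathbb{Z}^n}\operatorname{vol}_d(A_z)$, where $A_z=\{x\in\mathbb{R}^d:(z,x)\in A\}$ and $\operatorname{vol}_d$ is $d$-dimensional Lebesgue measure. A closed halfspace in $\mathbb{R}^{n+d}$ is a set $\{y: a^{\mathsf T}y\ge c\}$ with $a\in\mathbb{R}^{n+d}\setminus\{0\}$, $c\in\mathbb{R}$. Here $e$ is the base of the natural logarithm.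 *)

theory Defs
  imports "HOL-Analysis.Analysis"
begin

text \<open>
  \<open>\<real>\<^sup>n \<times> \<real>\<^sup>d\<close> is the Euclidean space \<open>(real^'n) \<times> (real^'d)\<close>, with
  \<open>n = CARD('n)\<close> and \<open>d = CARD('d)\<close>; both are at least 1 since types are nonempty.
\<close>

definition convex_body :: "'a::euclidean_space set \<Rightarrow> bool" where
  "convex_body C \<longleftrightarrow> compact C \<and> convex C \<and> interior C \<noteq> {}"

definition closed_halfspace :: "'a::euclidean_space set \<Rightarrow> bool" where
  "closed_halfspace H \<longleftrightarrow> (\<exists>a c. a \<noteq> 0 \<and> H = {y. a \<bullet> y \<ge> c})"

definition integer_points :: "(real ^ 'n) set" where
  "integer_points = {z. \<forall>i. z $ i \<in> \<int>}"

definition unit_ball_infty :: "(real ^ 'n) set" where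
  "unit_ball_infty = {u. infnorm u \<le> 1}"

text \<open>
  The mixed-integer volume is \<^typ>\<open>ennreal\<close>-valued, so the sum over all
  integer points always exists (possibly \<open>\<infinity>\<close>).
\<close>

definition mixed_integer_volume :: "((real ^ 'n) \<times> (real ^ 'd)) set \<Rightarrow> ennreal" where
  "mixed_integer_volume A =
     (\<Sum>\<^sub>\<infinity>z\<in>integer_points. emeasure lebesgue {x. (z, x) \<in> A})"

end

theory Submission
  imports Defs
begin

text \<open>
  Let \<open>N = n + d\<close>, \<open>\<kappa> = 1/(2k)\<close> and let \<open>g\<close> be the centroid of \<open>C\<close>. By Gruenbaum's inequality every
  halfspace through \<open>g\<close> contains a fraction \<open>1/e\<close> of the volume of \<open>C\<close>; this follows from
  log-concavity of \<open>s \<mapsto> vol {p \<in> C. a \<bullet> p \<ge> s}\<close>, a consequence of the Prekopa-Leindler inequality.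

  Since the projection of \<open>C\<close> contains a cube of half-width \<open>k\<close>, a contraction of \<open>C\<close> with factor
  \<open>1 - \<kappa>\<close> towards points of \<open>C\<close> above this cube can be used to move any point of \<open>C\<close> to the fiber over
  a nearest integer point. Applied to \<open>g\<close> this produces \<open>y\<close>. Applied to whole fibers it compares the
  mixed-integer volume with the Lebesgue volume: passing from one to the other costs only factors
  \<open>(1 - \<kappa>)^N\<close> and \<open>(1 + \<kappa>)^N\<close>. No control of the chosen points in the direction \<open>a\<close> of the halfspace
  is available, but they cost at most \<open>\<kappa>\<close> times the width of \<open>C\<close> in that direction, and a slab of
  relative width \<open>\<tau>\<close> has relative volume at most \<open>2N\<tau>\<close>.
\<close>

section \<open>The Prekopa-Leindler inequality for midpoints\<close>

lemma nn_integral_lborel_affine: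
  fixes f :: "'a::euclidean_space \<Rightarrow> ennreal"
  assumes [measurable]: "f \<in> borel_measurable borel" and c: "c \<noteq> 0"
  shows "(\<integral>\<^sup>+x. f x \<partial>lborel) = ennreal (\<bar>c\<bar> ^ DIM('a)) * (\<integral>\<^sup>+x. f (t + c *\<^sub>R x) \<partial>lborel)"
  by (subst lborel_affine[OF c, of t])
     (simp add: nn_integral_density nn_integral_distr nn_integral_cmult)

text \<open>Each value \<open>F x\<close> is the length of the set of levels \<open>t\<close> with
  \<open>0 < t\<close> and \<open>t < F x\<close>; Tonelli then exchanges the integrals over points
  and levels.\<close>

lemma nn_integral_layer_cake:
  fixes F :: "'a::euclidean_space \<Rightarrow> ennreal"
  assumes [measurable]: "F \<in> borel_measurable borel"
  shows "(\<integral>\<^sup>+x. F x \<partial>lborel) = (\<integral>\<^sup>+t. emeasure lborel {x. ennreal t < F x} * indicator {0<..} t \<partial>lborel)"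
proof -
  have level: "(\<integral>\<^sup>+t. indicator {t. 0 < t \<and> ennreal t < v} t \<partial>lborel) = v" for v
  proof (cases v)
    case (real r)
    then have "{t. 0 < t \<and> ennreal t < v} = {0<..<r}"
      by (auto simp: ennreal_less_iff)
    with real show ?thesis by simp
  next
    case top
    then have "{t. 0 < t \<and> ennreal t < v} = {0<..}"
      by (auto simp: ennreal_less_top)
    moreover have "emeasure lborel {0::real<..} = top"
    proof -
      have Ioc_subset: "{0<..b} \<subseteq> {0<..}" for b :: real by auto
      have "of_nat n \<le> emeasure lborel {0::real<..}" for n
        using emeasure_mono[OF Ioc_subset[of "real n"], of lborel] by (simp add: ennreal_of_nat_eq_real_of_nat)
      then show ?thesis
        using ennreal_Ex_less_of_nat[of "emeasure lborel {0::real<..}"]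
        by (metis less_top linorder_not_less)
    qed
    ultimately show ?thesis using top by simp
  qed
  have "(\<integral>\<^sup>+x. F x \<partial>lborel) = (\<integral>\<^sup>+x. \<integral>\<^sup>+t. indicator {t. 0 < t \<and> ennreal t < F x} t \<partial>lborel \<partial>lborel)"
    by (simp only: level)
  also have "\<dots> = (\<integral>\<^sup>+x. \<integral>\<^sup>+t. indicator {q. 0 < snd q \<and> ennreal (snd q) < F (fst q)} (x, t) \<partial>lborel \<partial>lborel)"
    by (intro nn_integral_cong) (auto split: split_indicator)
  also have "\<dots> = (\<integral>\<^sup>+t. \<integral>\<^sup>+x. indicator {q. 0 < snd q \<and> ennreal (snd q) < F (fst q)} (x, t) \<partial>lborel \<partial>lborel)"
    by (rule lborel_pair.Fubini'[symmetric]) measurable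
  also have "\<dots> = (\<integral>\<^sup>+t. \<integral>\<^sup>+x. indicator {x. ennreal t < F x} x * indicator {0<..} t \<partial>lborel \<partial>lborel)"
    by (intro nn_integral_cong) (auto split: split_indicator)
  also have "\<dots> = (\<integral>\<^sup>+t. emeasure lborel {x. ennreal t < F x} * indicator {0<..} t \<partial>lborel)"
    by (intro nn_integral_cong) (simp add: nn_integral_multc)
  finally show ?thesis .
qed

section \<open>Brunn-Minkowski on the real line\<close>

lemma brunn_minkowski_real_split:
  fixes A B D :: "real set"
  assumes [measurable]: "A \<in> sets borel" "B \<in> sets borel" "D \<in> sets borel"
    and mid: "\<And>x y. x \<in> A \<Longrightarrow> y \<in> B \<Longrightarrow> (x + y) / 2 \<in> D"
    and ab: "a \<in> A" "b \<in> B"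
  shows "emeasure lborel (A \<inter> {..<a}) + emeasure lborel (B \<inter> {b..}) \<le> 2 * emeasure lborel D"
proof -
  have half: "emeasure lborel S = 2 * emeasure lborel {y. 2 * y - t \<in> S}"
    if [measurable]: "S \<in> sets borel" for S :: "real set" and t
  proof -
    have "emeasure lborel S = (\<integral>\<^sup>+x. indicator S x \<partial>lborel)" by simp
    also have "\<dots> = ennreal 2 * (\<integral>\<^sup>+x. indicator S (- t + 2 *\<^sub>R x) \<partial>lborel)"
      using nn_integral_lborel_affine[of "indicator S :: real \<Rightarrow> ennreal" 2 "-t"] by simp
    also have "(\<integral>\<^sup>+x. indicator S (- t + 2 *\<^sub>R x) \<partial>lborel) = (\<integral>\<^sup>+x. indicator {y. 2 * y - t \<in> S} x \<partial>lborel)"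
      by (intro nn_integral_cong) (auto split: split_indicator)
    also have "\<dots> = emeasure lborel {y. 2 * y - t \<in> S}"
      by simp
    finally show ?thesis by simp
  qed
  \<comment> \<open>\<open>(A \<inter> {..<a}) + b\<close> and \<open>(B \<inter> {b..}) + a\<close> lie in \<open>2D\<close>, on different sides of \<open>a + b\<close>.\<close>
  let ?P = "{y. 2 * y - b \<in> A \<inter> {..<a}}" and ?Q = "{y. 2 * y - a \<in> B \<inter> {b..}}"
  have "emeasure lborel ?P + emeasure lborel ?Q = emeasure lborel (?P \<union> ?Q)"
    by (rule plus_emeasure) (measurable, auto)
  also have "\<dots> \<le> emeasure lborel D"
  proof (rule emeasure_mono)
    show "?P \<union> ?Q \<subseteq> D"
      using mid[OF _ ab(2)] mid[OF ab(1)] by (auto, force+)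
  qed simp
  finally have "emeasure lborel ?P + emeasure lborel ?Q \<le> emeasure lborel D" .
  from mult_left_mono[OF this, of 2] show ?thesis
    using half[of "A \<inter> {..<a}" b] half[of "B \<inter> {b..}" a] by (simp add: distrib_left)
qed

text \<open>With \<open>a\<close> near \<open>Sup A\<close> and \<open>b\<close> near
  \<open>Inf B\<close>, the parts of \<open>A\<close> above \<open>a\<close> and of \<open>B\<close>
  below \<open>b\<close> have length at most \<open>e / 2\<close> each, so the split inequality
  loses at most \<open>e\<close>.\<close>

lemma brunn_minkowski_real_bounded:
  fixes A B D :: "real set"
  assumes [measurable]: "A \<in> sets borel" "B \<in> sets borel" "D \<in> sets borel"
    and mid: "\<And>x y. x \<in> A \<Longrightarrow> y \<in> B \<Longrightarrow> (x + y) / 2 \<in> D"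
    and ne: "A \<noteq> {}" "B \<noteq> {}" and bd: "bdd_above A" "bdd_below B"
  shows "emeasure lborel A + emeasure lborel B \<le> 2 * emeasure lborel D"
proof (rule ennreal_le_epsilon)
  fix e :: real assume e: "0 < e"
  obtain a where a: "a \<in> A" "Sup A - e / 2 < a"
    using less_cSupD[OF ne(1), of "Sup A - e/2"] e by auto
  obtain b where b: "b \<in> B" "b < Inf B + e / 2"
    using cInf_lessD[OF ne(2), of "Inf B + e/2"] e by auto
  have "emeasure lborel A \<le> emeasure lborel ((A \<inter> {..<a}) \<union> {a..a + e/2})"
  proof (rule emeasure_mono)
    show "A \<subseteq> (A \<inter> {..<a}) \<union> {a..a + e/2}"
      using cSup_upper[OF _ bd(1)] a(2) by (fastforce simp: not_less)
  qed simp
  also have "\<dots> \<le> emeasure lborel (A \<inter> {..<a}) + emeasure lborel {a..a + e/2}"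
    by (rule emeasure_subadditive) auto
  finally have 1: "emeasure lborel A \<le> emeasure lborel (A \<inter> {..<a}) + ennreal (e/2)"
    using e by simp
  have "emeasure lborel B \<le> emeasure lborel ((B \<inter> {b..}) \<union> {b - e/2..b})"
  proof (rule emeasure_mono)
    show "B \<subseteq> (B \<inter> {b..}) \<union> {b - e/2..b}"
      using cInf_lower[OF _ bd(2)] b(2) by (fastforce simp: not_le)
  qed simp
  also have "\<dots> \<le> emeasure lborel (B \<inter> {b..}) + emeasure lborel {b - e/2..b}"
    by (rule emeasure_subadditive) auto
  finally have 2: "emeasure lborel B \<le> emeasure lborel (B \<inter> {b..}) + ennreal (e/2)"
    using e by simp
  have "emeasure lborel A + emeasure lborel B \<le>
      (emeasure lborel (A \<inter> {..<a}) + emeasure lborel (B \<inter> {b..})) + (ennreal (e/2) + ennreal (e/2))"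
    using add_mono[OF 1 2] by (simp add: ac_simps)
  also have "\<dots> \<le> 2 * emeasure lborel D + ennreal e"
    using e by (intro add_mono brunn_minkowski_real_split mid a b) (auto simp: ennreal_plus[symmetric] simp del: ennreal_plus)
  finally show "emeasure lborel A + emeasure lborel B \<le> 2 * emeasure lborel D + ennreal e" .
qed

text \<open>Truncating \<open>A\<close> from above and \<open>B\<close> from below exhausts both
  sets, and the bounded case passes to the limit.\<close>

lemma brunn_minkowski_real:
  fixes A B D :: "real set"
  assumes [measurable]: "A \<in> sets borel" "B \<in> sets borel" "D \<in> sets borel"
    and mid: "\<And>x y. x \<in> A \<Longrightarrow> y \<in> B \<Longrightarrow> (x + y) / 2 \<in> D"
    and ne: "A \<noteq> {}" "B \<noteq> {}"
  shows "emeasure lborel A + emeasure lborel B \<le> 2 * emeasure lborel D"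
proof -
  obtain a b where ab: "a \<in> A" "b \<in> B" using ne by auto
  \<comment> \<open>The offsets keep \<open>a\<close> and \<open>b\<close> in every truncation, so
    that none of them is empty.\<close>
  let ?A = "\<lambda>n::nat. A \<inter> {..\<bar>a\<bar> + real n}" and ?B = "\<lambda>n::nat. B \<inter> {- \<bar>b\<bar> - real n..}"
  have A: "(\<lambda>n. emeasure lborel (?A n)) \<longlonglongrightarrow> emeasure lborel (\<Union>n. ?A n)"
    by (rule Lim_emeasure_incseq) (auto simp: incseq_def)
  have B: "(\<lambda>n. emeasure lborel (?B n)) \<longlonglongrightarrow> emeasure lborel (\<Union>n. ?B n)"
    by (rule Lim_emeasure_incseq) (auto simp: incseq_def)
  have "(\<Union>n. ?A n) = A"
  proof (intro equalityI subsetI)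
    fix x assume "x \<in> A"
    obtain n :: nat where "x < real n" using reals_Archimedean2 by blast
    with \<open>x \<in> A\<close> show "x \<in> (\<Union>n. ?A n)" by (auto intro!: exI[of _ n])
  qed auto
  moreover have "(\<Union>n. ?B n) = B"
  proof (intro equalityI subsetI)
    fix x assume "x \<in> B"
    obtain n :: nat where "- x < real n" using reals_Archimedean2 by blast
    with \<open>x \<in> B\<close> show "x \<in> (\<Union>n. ?B n)" by (auto intro!: exI[of _ n])
  qed auto
  ultimately have "(\<lambda>n. emeasure lborel (?A n) + emeasure lborel (?B n)) \<longlonglongrightarrow> emeasure lborel A + emeasure lborel B"
    using tendsto_add[OF A B] by simp
  moreover have "emeasure lborel (?A n) + emeasure lborel (?B n) \<le> 2 * emeasure lborel D" for n
  proof (rule brunn_minkowski_real_bounded)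
    show "?A n \<noteq> {}" "?B n \<noteq> {}"
      using ab by (auto intro!: exI[of _ a] exI[of _ b])
  qed (use mid in \<open>auto intro!: bdd_above_Int2 bdd_below_Int2\<close>)
  ultimately show ?thesis
    by (blast intro: LIMSEQ_le_const2)
qed

section \<open>From superlevel sets to the Prekopa-Leindler inequality\<close>

text \<open>As both suprema are 1, the superlevel sets of \<open>f\<close> and \<open>g\<close> are
  nonempty at every level below 1, and their midpoints lie in that of \<open>h\<close>.
  One-dimensional Brunn-Minkowski is applied level by level and integrated by the layer cake
  formula.\<close>

lemma prekopa_leindler_real_normalized:
  fixes f g h :: "real \<Rightarrow> ennreal"
  assumes [measurable]: "f \<in> borel_measurable borel" "g \<in> borel_measurable borel" "h \<in> borel_measurable borel"
    and f: "(SUP x. f x) = 1" and g: "(SUP x. g x) = 1"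
    and mid: "\<And>x y. f x * g y \<le> (h ((x + y) / 2))\<^sup>2"
  shows "(\<integral>\<^sup>+x. f x \<partial>lborel) + (\<integral>\<^sup>+x. g x \<partial>lborel) \<le> 2 * (\<integral>\<^sup>+x. h x \<partial>lborel)"
proof -
  let ?L = "\<lambda>F t. emeasure lborel {x::real. ennreal t < F x}"
  have vanish: "?L F t = 0" if "(SUP x. F x) = 1" "1 \<le> t" for F :: "real \<Rightarrow> ennreal" and t
  proof -
    have "F x \<le> ennreal t" for x
      using SUP_upper[of x UNIV F] that by (metis UNIV_I ennreal_1 ennreal_leI order_trans)
    then have "{x. ennreal t < F x} = {}" by (auto simp: not_less)
    then show ?thesis by simp
  qed
  have step: "?L f t + ?L g t \<le> 2 * ?L h t" if t: "0 < t" for t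
  proof (cases "t < 1")
    case True
    then have t1: "ennreal t < 1" using t by (simp add: ennreal_less_one_iff)
    show ?thesis
    proof (rule brunn_minkowski_real)
      fix x y assume "x \<in> {x. ennreal t < f x}" "y \<in> {x. ennreal t < g x}"
      then have xy: "ennreal t < f x" "ennreal t < g y" by auto
      have "(ennreal t)\<^sup>2 < ennreal t * g y"
        unfolding power2_eq_square using xy t by (intro ennreal_mult_strict_left_mono) auto
      also have "\<dots> \<le> f x * g y"
        using xy by (intro mult_right_mono) auto
      also note mid
      finally have "ennreal t < h ((x + y) / 2)"
        by (meson not_le power_mono zero_le)
      then show "(x + y) / 2 \<in> {x. ennreal t < h x}" by simp
    next
      show "{x. ennreal t < f x} \<noteq> {}"
        using t1 less_SUP_iff[of "ennreal t" f UNIV] unfolding f by auto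
      show "{x. ennreal t < g x} \<noteq> {}"
        using t1 less_SUP_iff[of "ennreal t" g UNIV] unfolding g by auto
    qed auto
  qed (use vanish f g in auto)
  have "(\<integral>\<^sup>+x. f x \<partial>lborel) + (\<integral>\<^sup>+x. g x \<partial>lborel)
      = (\<integral>\<^sup>+t. (?L f t + ?L g t) * indicator {0<..} t \<partial>lborel)"
    by (simp add: nn_integral_layer_cake[of f] nn_integral_layer_cake[of g] distrib_right nn_integral_add)
  also have "\<dots> \<le> (\<integral>\<^sup>+t. 2 * (?L h t * indicator {0<..} t) \<partial>lborel)"
    by (rule nn_integral_mono) (use step in \<open>auto split: split_indicator\<close>)
  also have "\<dots> = 2 * (\<integral>\<^sup>+x. h x \<partial>lborel)"
    by (simp add: nn_integral_layer_cake[of h] nn_integral_cmult)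
  finally show ?thesis .
qed

text \<open>Boundedness makes the suprema finite, so scaling reduces to the normalized case. The
  resulting additive inequality becomes multiplicative by the arithmetic-geometric mean
  inequality.\<close>

lemma prekopa_leindler_real_bounded:
  fixes f g h :: "real \<Rightarrow> ennreal"
  assumes [measurable]: "f \<in> borel_measurable borel" "g \<in> borel_measurable borel" "h \<in> borel_measurable borel"
    and f: "\<And>x. f x \<le> ennreal m" and g: "\<And>x. g x \<le> ennreal n"
    and mid: "\<And>x y. f x * g y \<le> (h ((x + y) / 2))\<^sup>2"
  shows "(\<integral>\<^sup>+x. f x \<partial>lborel) * (\<integral>\<^sup>+x. g x \<partial>lborel) \<le> (\<integral>\<^sup>+x. h x \<partial>lborel)\<^sup>2"
proof -
  have fin: "(SUP x. f x) < top" "(SUP x. g x) < top"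
    using SUP_least[of UNIV f, OF f] SUP_least[of UNIV g, OF g]
    by (meson ennreal_less_top le_less_trans)+
  show ?thesis
  proof (cases "(SUP x. f x) = 0 \<or> (SUP x. g x) = 0")
    case True
    then have "(\<forall>x. f x = 0) \<or> (\<forall>x. g x = 0)"
      by (metis SUP_upper UNIV_I le_zero_eq)
    then show ?thesis by auto
  next
    case False
    obtain a where a: "(SUP x. f x) = ennreal a" "0 < a"
      using fin(1) False by (cases "SUP x. f x") (auto simp: zero_less_iff_neq_zero less_le)
    obtain b where b: "(SUP x. g x) = ennreal b" "0 < b"
      using fin(2) False by (cases "SUP x. g x") (auto simp: zero_less_iff_neq_zero less_le)
    \<comment> \<open>Scaling \<open>f\<close> by \<open>1 / a\<close> and \<open>g\<close> by
      \<open>1 / b\<close> forces the factor \<open>1 / c\<close> on \<open>h\<close>, because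
      \<open>h\<close> enters the hypothesis squared.\<close>
    define c where "c = sqrt (a * b)"
    have c: "0 < c" "c\<^sup>2 = a * b" using a b by (auto simp: c_def)
    let ?a = "ennreal (1 / a)" and ?b = "ennreal (1 / b)" and ?c = "ennreal (1 / c)"
    let ?P = "\<integral>\<^sup>+x. f x \<partial>lborel" and ?Q = "\<integral>\<^sup>+x. g x \<partial>lborel" and ?R = "\<integral>\<^sup>+x. h x \<partial>lborel"
    have "(\<integral>\<^sup>+x. ?a * f x \<partial>lborel) + (\<integral>\<^sup>+x. ?b * g x \<partial>lborel) \<le> 2 * (\<integral>\<^sup>+x. ?c * h x \<partial>lborel)"
    proof (rule prekopa_leindler_real_normalized)
      show "(SUP x. ?a * f x) = 1" "(SUP x. ?b * g x) = 1"
        using a b by (simp_all add: SUP_mult_left_ennreal[symmetric] ennreal_mult'[symmetric])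
      fix x y
      have "?a * f x * (?b * g y) = ennreal (1 / (a * b)) * (f x * g y)"
        using a b ennreal_mult'[of "1/a" "1/b"] by (simp add: ac_simps)
      also have "\<dots> \<le> ennreal (1 / (a * b)) * (h ((x + y) / 2))\<^sup>2"
        by (intro mult_left_mono mid) simp
      also have "\<dots> = (?c * h ((x + y) / 2))\<^sup>2"
        using c by (simp add: power_mult_distrib ennreal_power power_one_over)
      finally show "?a * f x * (?b * g y) \<le> (?c * h ((x + y) / 2))\<^sup>2" .
    qed simp_all
    then have ineq: "?a * ?P + ?b * ?Q \<le> 2 * (?c * ?R)"
      by (simp add: nn_integral_cmult)
    show ?thesis
    proof (cases "?R = top")
      case True
      then show ?thesis by (simp add: power2_eq_square)
    next
      case False
      then obtain r where r: "?R = ennreal r" "0 \<le> r" by (cases ?R) auto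
      then have "2 * (?c * ?R) = ennreal (2 * (r / c))"
        using c by (simp add: ennreal_mult[symmetric] ennreal_mult'[symmetric] del: ennreal_numeral flip: ennreal_numeral)
      with ineq have le: "?a * ?P + ?b * ?Q \<le> ennreal (2 * (r / c))" by simp
      then have "?a * ?P + ?b * ?Q < top"
        using ennreal_less_top by (rule le_less_trans)
      then have top: "?a * ?P < top" "?b * ?Q < top" by (simp_all add: ennreal_add_less_top)
      obtain p where p: "?P = ennreal p" "0 \<le> p"
        using top(1) a by (cases ?P) (auto simp: ennreal_mult_top)
      obtain q where q: "?Q = ennreal q" "0 \<le> q"
        using top(2) b by (cases ?Q) (auto simp: ennreal_mult_top)
      have "ennreal (p / a + q / b) \<le> ennreal (2 * (r / c))"
        using le p q a b
        by (simp add: ennreal_mult'[symmetric])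
      then have "p / a + q / b \<le> 2 * (r / c)"
        using r c by (subst (asm) ennreal_le_iff) auto
      then have "(p / a + q / b)\<^sup>2 \<le> (2 * (r / c))\<^sup>2"
        using a b p q by (intro power_mono) auto
      moreover have "4 * ((p / a) * (q / b)) \<le> (p / a + q / b)\<^sup>2"
        using zero_le_power2[of "p / a - q / b"] by (simp only: power2_diff power2_sum)
      ultimately have "(p * q) / (a * b) \<le> r\<^sup>2 / (a * b)"
        using c by (simp add: power_mult_distrib power_divide)
      then have "p * q \<le> r\<^sup>2"
        using a b by (simp add: divide_le_cancel)
      then show ?thesis
        using p q r by (simp add: ennreal_mult'[symmetric] ennreal_power)
    qed
  qed
qed

text \<open>Cutting \<open>f\<close> and \<open>g\<close> off at natural numbers preserves the
  hypothesis, and monotone convergence restores the full integrals.\<close>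

lemma prekopa_leindler_real:
  fixes f g h :: "real \<Rightarrow> ennreal"
  assumes [measurable]: "f \<in> borel_measurable borel" "g \<in> borel_measurable borel" "h \<in> borel_measurable borel"
    and mid: "\<And>x y. f x * g y \<le> (h ((x + y) / 2))\<^sup>2"
  shows "(\<integral>\<^sup>+x. f x \<partial>lborel) * (\<integral>\<^sup>+x. g x \<partial>lborel) \<le> (\<integral>\<^sup>+x. h x \<partial>lborel)\<^sup>2"
proof -
  have trunc: "(\<integral>\<^sup>+x. F x \<partial>lborel) = (SUP n::nat. \<integral>\<^sup>+x. min (F x) (of_nat n) \<partial>lborel)"
    if [measurable]: "F \<in> borel_measurable borel" for F :: "real \<Rightarrow> ennreal"
  proof -
    have "F x = (SUP n::nat. min (F x) (of_nat n))" for x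
    proof -
      have "(SUP n::nat. min (F x) (of_nat n)) = min (F x) (SUP n. of_nat n)"
        by (simp add: inf_min[symmetric] inf_SUP)
      then show ?thesis by (simp add: ennreal_SUP_of_nat_eq_top)
    qed
    then have "(\<integral>\<^sup>+x. F x \<partial>lborel) = (\<integral>\<^sup>+x. (SUP n::nat. min (F x) (of_nat n)) \<partial>lborel)"
      by simp
    also have "\<dots> = (SUP n::nat. \<integral>\<^sup>+x. min (F x) (of_nat n) \<partial>lborel)"
      by (rule nn_integral_monotone_convergence_SUP)
         (auto simp: incseq_def le_fun_def intro: min.coboundedI2 order_trans)
    finally show ?thesis .
  qed
  have "(\<integral>\<^sup>+x. min (f x) (of_nat m) \<partial>lborel) * (\<integral>\<^sup>+x. min (g x) (of_nat n) \<partial>lborel)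
      \<le> (\<integral>\<^sup>+x. h x \<partial>lborel)\<^sup>2" for m n
  proof (rule prekopa_leindler_real_bounded[where m = "real m" and n = "real n"])
    fix x y
    have "min (f x) (of_nat m) * min (g y) (of_nat n) \<le> f x * g y"
      by (intro mult_mono) auto
    also note mid
    finally show "min (f x) (of_nat m) * min (g y) (of_nat n) \<le> (h ((x + y) / 2))\<^sup>2" .
  qed (auto simp: ennreal_of_nat_eq_real_of_nat)
  then show ?thesis
    by (simp add: trunc[of f] trunc[of g] SUP_mult_left_ennreal SUP_mult_right_ennreal SUP_le_iff)
qed

text \<open>Induction on the coordinates: with coordinate \<open>i\<close> frozen, the induction
  hypothesis says that the slice integrals, as functions of that coordinate, satisfy the hypothesis
  of the one-dimensional inequality.\<close>

lemma prekopa_leindler_PiM: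
  fixes f g h :: "('i \<Rightarrow> real) \<Rightarrow> ennreal"
  assumes "finite I"
    and "f \<in> borel_measurable (\<Pi>\<^sub>M i\<in>I. lborel)" "g \<in> borel_measurable (\<Pi>\<^sub>M i\<in>I. lborel)"
      "h \<in> borel_measurable (\<Pi>\<^sub>M i\<in>I. lborel)"
    and "\<And>x y. x \<in> extensional I \<Longrightarrow> y \<in> extensional I \<Longrightarrow> f x * g y \<le> (h (\<lambda>i\<in>I. (x i + y i) / 2))\<^sup>2"
  shows "integral\<^sup>N (\<Pi>\<^sub>M i\<in>I. lborel) f * integral\<^sup>N (\<Pi>\<^sub>M i\<in>I. lborel) g \<le> (integral\<^sup>N (\<Pi>\<^sub>M i\<in>I. lborel) h)\<^sup>2"
  using assms
proof (induction I arbitrary: f g h rule: finite_induct)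
  case empty
  interpret product_sigma_finite "\<lambda>_::'i. lborel :: real measure" ..
  \<comment> \<open>The empty product has a single point, the function that is
    \<open>undefined\<close> everywhere.\<close>
  have "restrict (\<lambda>i. (undefined i + undefined i) / 2) {} = (\<lambda>_. undefined :: real)"
    by auto
  with empty(4)[of "\<lambda>_. undefined" "\<lambda>_. undefined"] show ?case
    by (simp add: PiM_empty nn_integral_count_space_finite)
next
  case (insert i I)
  interpret product_sigma_finite "\<lambda>_::'i. lborel :: real measure" ..
  note [measurable] = insert.prems(1-3)
  have slice: "(\<lambda>s. \<integral>\<^sup>+x. F (x(i := s)) \<partial>(\<Pi>\<^sub>M i\<in>I. lborel)) \<in> borel_measurable borel"
    if [measurable]: "F \<in> borel_measurable (\<Pi>\<^sub>M i\<in>insert i I. lborel)" for F :: "('i \<Rightarrow> real) \<Rightarrow> ennreal"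
  proof -
    interpret finite_product_sigma_finite "\<lambda>_::'i. lborel :: real measure" I
      by standard (rule insert)
    show ?thesis by measurable
  qed
  have "(\<integral>\<^sup>+s. \<integral>\<^sup>+x. f (x(i := s)) \<partial>(\<Pi>\<^sub>M i\<in>I. lborel) \<partial>lborel) * (\<integral>\<^sup>+s. \<integral>\<^sup>+x. g (x(i := s)) \<partial>(\<Pi>\<^sub>M i\<in>I. lborel) \<partial>lborel)
     \<le> (\<integral>\<^sup>+s. \<integral>\<^sup>+x. h (x(i := s)) \<partial>(\<Pi>\<^sub>M i\<in>I. lborel) \<partial>lborel)\<^sup>2"
  proof (rule prekopa_leindler_real)
    fix s t
    show "(\<integral>\<^sup>+x. f (x(i := s)) \<partial>(\<Pi>\<^sub>M i\<in>I. lborel)) * (\<integral>\<^sup>+x. g (x(i := t)) \<partial>(\<Pi>\<^sub>M i\<in>I. lborel))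
       \<le> (\<integral>\<^sup>+x. h (x(i := (s + t) / 2)) \<partial>(\<Pi>\<^sub>M i\<in>I. lborel))\<^sup>2"
    proof (rule insert.IH)
      fix x y :: "'i \<Rightarrow> real" assume xy: "x \<in> extensional I" "y \<in> extensional I"
      then have ext: "x(i := s) \<in> extensional (insert i I)" "y(i := t) \<in> extensional (insert i I)"
        by (auto simp: extensional_def)
      have "(\<lambda>j\<in>insert i I. ((x(i := s)) j + (y(i := t)) j) / 2) = (\<lambda>j\<in>I. (x j + y j) / 2)(i := (s + t) / 2)"
        using insert.hyps by (auto simp: fun_eq_iff)
      from insert.prems(4)[OF ext, unfolded this]
      show "f (x(i := s)) * g (y(i := t)) \<le> (h ((\<lambda>j\<in>I. (x j + y j) / 2)(i := (s + t) / 2)))\<^sup>2" .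
    qed measurable
  qed (rule slice; measurable)+
  then show ?case
    by (simp add: product_nn_integral_insert_rev insert.hyps)
qed

text \<open>The multiplicative form of Brunn-Minkowski: Prekopa-Leindler for indicator functions, in
  coordinates with respect to \<open>Basis\<close>.\<close>

lemma brunn_minkowski_midpoint:
  fixes A B D :: "'a::euclidean_space set"
  assumes [measurable]: "A \<in> sets borel" "B \<in> sets borel" "D \<in> sets borel"
    and mid: "\<And>x y. x \<in> A \<Longrightarrow> y \<in> B \<Longrightarrow> midpoint x y \<in> D"
  shows "emeasure lborel A * emeasure lborel B \<le> (emeasure lborel D)\<^sup>2"
proof -
  let ?v = "\<lambda>x. \<Sum>b\<in>Basis. x b *\<^sub>R b :: 'a"
  have eq: "emeasure lborel S = (\<integral>\<^sup>+x. indicator S (?v x) \<partial>(\<Pi>\<^sub>M b\<in>Basis. lborel))"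
    if [measurable]: "S \<in> sets borel" for S :: "'a set"
  proof -
    have "emeasure lborel S = (\<integral>\<^sup>+x. indicator S x \<partial>lborel)" by simp
    also have "\<dots> = (\<integral>\<^sup>+x. indicator S (?v x) \<partial>(\<Pi>\<^sub>M b\<in>Basis. lborel))"
      by (subst lborel_eq, subst nn_integral_distr) auto
    finally show ?thesis .
  qed
  show ?thesis
    unfolding eq[OF assms(1)] eq[OF assms(2)] eq[OF assms(3)]
  proof (rule prekopa_leindler_PiM)
    fix x y :: "'a \<Rightarrow> real"
    have "?v (\<lambda>b\<in>Basis. (x b + y b) / 2) = midpoint (?v x) (?v y)"
      by (simp add: midpoint_def scaleR_sum_right sum.distrib[symmetric] scaleR_add_left[symmetric] scaleR_add_right)
    with mid[of "?v x" "?v y"]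
    show "(indicator A (?v x) :: ennreal) * indicator B (?v y) \<le> (indicator D (?v (\<lambda>b\<in>Basis. (x b + y b) / 2)))\<^sup>2"
      by (auto split: split_indicator)
  qed auto
qed

section \<open>Gruenbaum's inequality\<close>

text \<open>After subtracting the chord, the function vanishes at both ends. A positive maximum
  would have a leftmost maximizer, and midpoint convexity there produces a maximizer further
  left.\<close>

lemma convex_on_midpoint_continuous:
  fixes f :: "real \<Rightarrow> real"
  assumes S: "is_interval S" and cont: "continuous_on S f"
    and mid: "\<And>x y. x \<in> S \<Longrightarrow> y \<in> S \<Longrightarrow> f ((x + y) / 2) \<le> (f x + f y) / 2"
  shows "convex_on S f"
proof (rule convex_onI)
  show "convex S" using S by (simp add: is_interval_convex)
next
  fix t x y :: real assume t: "0 < t" "t < 1" and xy: "x \<in> S" "y \<in> S"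
  define w where "w s = (1 - s) *\<^sub>R x + s *\<^sub>R y" for s :: real
  have wS: "w s \<in> S" if "s \<in> {0..1}" for s
    using convexD[of S x y "1 - s" s] S xy that by (auto simp: w_def is_interval_convex)
  define g where "g s = f (w s) - ((1 - s) * f x + s * f y)" for s
  have cg: "continuous_on {0..1} g"
  proof -
    have "continuous_on {0..1} (\<lambda>s. f (w s))"
      by (rule continuous_on_compose2[OF cont]) (use wS in \<open>auto simp: w_def intro!: continuous_intros\<close>)
    then show ?thesis unfolding g_def by (intro continuous_intros)
  qed
  have gmid: "g ((r + s) / 2) \<le> (g r + g s) / 2" if "r \<in> {0..1}" "s \<in> {0..1}" for r s
  proof -
    have "w ((r + s) / 2) = (w r + w s) / 2" by (simp add: w_def field_simps)
    with mid[OF wS wS, OF that] have "f (w ((r + s) / 2)) \<le> (f (w r) + f (w s)) / 2"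
      by (simp only:)
    then show ?thesis by (simp add: g_def field_simps)
  qed
  have g01: "g 0 = 0" "g 1 = 0" by (simp_all add: g_def w_def)
  obtain m where m: "m \<in> {0..1}" "\<And>s. s \<in> {0..1} \<Longrightarrow> g s \<le> g m"
    using continuous_attains_sup[OF _ _ cg] by auto
  let ?M = "{s \<in> {0..1}. g s = g m}"
  have "closed ?M"
    by (rule continuous_closed_preimage_constant[OF cg]) simp
  moreover have "bounded ?M"
    by (rule bounded_subset[OF bounded_closed_interval[of 0 1]]) auto
  ultimately have "compact ?M"
    unfolding compact_eq_bounded_closed by blast
  moreover have "?M \<noteq> {}" using m by auto
  ultimately have "\<exists>p\<in>?M. \<forall>s\<in>?M. p \<le> s"
    by (rule compact_attains_inf)
  then obtain p where p: "p \<in> ?M" "\<And>s. s \<in> ?M \<Longrightarrow> p \<le> s" by blast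
  have "g m \<le> 0"
  proof (rule ccontr)
    assume "\<not> g m \<le> 0"
    then have "p \<noteq> 0" "p \<noteq> 1" using p(1) g01 by auto
    then have p01: "0 < p" "p < 1" using p(1) by auto
    \<comment> \<open>The distance from \<open>p\<close> to the nearer end keeps
      \<open>p - d\<close> and \<open>p + d\<close> inside the unit interval.\<close>
    define d where "d = min p (1 - p)"
    have d: "0 < d" "p - d \<in> {0..1}" "p + d \<in> {0..1}" using p01 by (auto simp: d_def)
    have "g p \<le> (g (p - d) + g (p + d)) / 2"
      using gmid[OF d(2,3)] by simp
    then have "g (p - d) = g m"
      using m(2)[OF d(2)] m(2)[OF d(3)] p(1) by auto
    then show False using p(2)[of "p - d"] d by auto
  qed
  then have "g t \<le> 0" using m(2)[of t] t by auto
  then show "f ((1 - t) *\<^sub>R x + t *\<^sub>R y) \<le> (1 - t) * f x + t * f y"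
    by (simp add: g_def w_def)
qed

lemma emeasure_lborel_affine_vimage:
  fixes S :: "'a::euclidean_space set"
  assumes [measurable]: "S \<in> sets borel" and "c \<noteq> 0"
  shows "emeasure lborel S = ennreal (\<bar>c\<bar> ^ DIM('a)) * emeasure lborel {x. t + c *\<^sub>R x \<in> S}"
proof -
  have "emeasure lborel S = (\<integral>\<^sup>+x. indicator S x \<partial>lborel)" by simp
  also have "\<dots> = ennreal (\<bar>c\<bar> ^ DIM('a)) * (\<integral>\<^sup>+x. indicator S (t + c *\<^sub>R x) \<partial>lborel)"
    using assms by (intro nn_integral_lborel_affine) auto
  also have "(\<integral>\<^sup>+x. indicator S (t + c *\<^sub>R x) \<partial>lborel) = (\<integral>\<^sup>+x. indicator {x. t + c *\<^sub>R x \<in> S} x \<partial>lborel)"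
    by (intro nn_integral_cong) (auto split: split_indicator)
  also have "\<dots> = emeasure lborel {x. t + c *\<^sub>R x \<in> S}" by simp
  finally show ?thesis .
qed

lemma emeasure_lborel_homothety_le:
  fixes S T :: "'a::euclidean_space set"
  assumes [measurable]: "S \<in> sets borel" "T \<in> sets borel" and c: "0 < c"
    and sub: "\<And>x. x \<in> S \<Longrightarrow> t + c *\<^sub>R x \<in> T"
  shows "ennreal (c ^ DIM('a)) * emeasure lborel S \<le> emeasure lborel T"
proof -
  have "emeasure lborel S \<le> emeasure lborel {x. t + c *\<^sub>R x \<in> T}"
    by (rule emeasure_mono) (use sub in auto)
  then show ?thesis
    using emeasure_lborel_affine_vimage[of T c t] c by (auto intro: mult_left_mono)
qed

section \<open>Volumes of caps of a convex body\<close>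

locale euclidean_convex_body =
  fixes C :: "'a::euclidean_space set"
  assumes body: "convex_body C"
begin

lemma compact: "compact C" and convex: "convex C" and interior: "interior C \<noteq> {}"
  using body by (auto simp: convex_body_def)

lemma nonempty: "C \<noteq> {}" using interior interior_subset by blast

lemma sets_borel [measurable]: "C \<in> sets borel"
  using compact by (simp add: borel_compact)

abbreviation volume :: real where "volume \<equiv> measure lborel C"

lemma emeasure_fin: "emeasure lborel C < top"
  using emeasure_compact_finite[OF compact] by simp

lemma fmeasurable_Int [simp]: "A \<in> sets borel \<Longrightarrow> C \<inter> A \<in> fmeasurable lborel"
  by (rule fmeasurableI2[of C]) (use emeasure_fin in \<open>auto intro!: fmeasurableI\<close>)

lemma volume_pos: "0 < volume"
proof -
  obtain x e where "0 < e" "ball x e \<subseteq> C" using interior by (metis equals0I mem_interior)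
  then have "measure lborel (ball x e) \<le> volume"
    using fmeasurable_Int[of UNIV] by (intro measure_mono_fmeasurable) auto
  with content_ball_pos[OF \<open>0 < e\<close>] show ?thesis by (rule less_le_trans)
qed

text \<open>Up to the factor \<open>volume\<close>, the tail distribution of
  \<open>a \<bullet> p\<close> for \<open>p\<close> uniform in \<open>C\<close>.\<close>

definition upper :: "'a \<Rightarrow> real \<Rightarrow> real" where
  "upper a s = measure lborel (C \<inter> {p. s \<le> a \<bullet> p})"

lemma upper_ennreal: "ennreal (upper a s) = emeasure lborel (C \<inter> {p. s \<le> a \<bullet> p})"
  unfolding upper_def by (rule emeasure_eq_measure2[symmetric]) simp

lemma upper_antimono: "s \<le> t \<Longrightarrow> upper a t \<le> upper a s"
  unfolding upper_def by (rule measure_mono_fmeasurable) auto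

lemma upper_nonneg [simp]: "0 \<le> upper a s" by (simp add: upper_def)

lemma upper_le_volume: "upper a s \<le> volume"
  unfolding upper_def using fmeasurable_Int[of UNIV] by (intro measure_mono_fmeasurable) auto

text \<open>Log-concavity at midpoints: by convexity of \<open>C\<close>, midpoints between two caps
  lie in the cap at the mean level.\<close>

lemma upper_midpoint: "upper a s * upper a t \<le> (upper a ((s + t) / 2))\<^sup>2"
proof -
  have "emeasure lborel (C \<inter> {p. s \<le> a \<bullet> p}) * emeasure lborel (C \<inter> {p. t \<le> a \<bullet> p})
     \<le> (emeasure lborel (C \<inter> {p. (s + t) / 2 \<le> a \<bullet> p}))\<^sup>2"
  proof (rule brunn_minkowski_midpoint)
    fix x y assume "x \<in> C \<inter> {p. s \<le> a \<bullet> p}" "y \<in> C \<inter> {p. t \<le> a \<bullet> p}"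
    then show "midpoint x y \<in> C \<inter> {p. (s + t) / 2 \<le> a \<bullet> p}"
      using convexD[OF convex, of x y "1/2" "1/2"]
      by (auto simp: midpoint_def inner_add_right scaleR_add_right)
  qed auto
  then show ?thesis
    unfolding upper_ennreal[symmetric]
    by (simp add: ennreal_mult'[symmetric] ennreal_power)
qed

lemma measure_hyperplane:
  assumes "a \<noteq> 0"
  shows "measure lborel (C \<inter> {p. a \<bullet> p = s}) = 0"
proof -
  have "negligible (C \<inter> {p. a \<bullet> p = s})"
    using negligible_hyperplane[of a s] assms by (blast intro: negligible_subset)
  then have "emeasure lebesgue (C \<inter> {p. a \<bullet> p = s}) = 0"
    by (simp add: negligible_iff_emeasure0 negligible_imp_measurable)
  then show ?thesis by (simp add: measure_def)
qed

text \<open>The indicators of the caps converge off the hyperplane at level \<open>s\<close>, which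
  is null in \<open>C\<close>, so dominated convergence applies. Continuity upgrades midpoint
  log-concavity to log-concavity.\<close>

lemma continuous_upper:
  assumes "a \<noteq> 0"
  shows "isCont (upper a) s"
proof -
  note null = measure_hyperplane[OF assms, of s]
  have lim: "(\<lambda>n. upper a (f n)) \<longlonglongrightarrow> upper a s" if f: "f \<longlonglongrightarrow> s" for f
  proof -
    have "(\<lambda>n. measure lborel (C \<inter> {p. f n \<le> a \<bullet> p})) = (\<lambda>n. \<integral>p. indicator (C \<inter> {p. f n \<le> a \<bullet> p}) p \<partial>lborel)"
      by simp
    moreover have "measure lborel (C \<inter> {p. s \<le> a \<bullet> p}) = (\<integral>p. indicator (C \<inter> {p. s \<le> a \<bullet> p}) p \<partial>lborel)"
      by simp
    moreover have "(\<lambda>n. \<integral>p. indicator (C \<inter> {p. f n \<le> a \<bullet> p}) p \<partial>lborel :: real) \<longlonglongrightarrow> (\<integral>p. indicator (C \<inter> {p. s \<le> a \<bullet> p}) p \<partial>lborel)"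
    proof (rule integral_dominated_convergence[where w = "indicator C"])
      show "integrable lborel (indicator C :: 'a \<Rightarrow> real)"
        using emeasure_fin by simp
      have "AE p in lborel. p \<notin> C \<inter> {p. a \<bullet> p = s}"
        by (rule AE_not_in) (use null fmeasurable_Int in \<open>auto simp: null_sets_def emeasure_eq_measure2\<close>)
      then show "AE p in lborel. (\<lambda>n. indicator (C \<inter> {p. f n \<le> a \<bullet> p}) p :: real) \<longlonglongrightarrow> indicator (C \<inter> {p. s \<le> a \<bullet> p}) p"
      proof eventually_elim
        case (elim p)
        consider "p \<notin> C" | "p \<in> C" "s < a \<bullet> p" | "p \<in> C" "a \<bullet> p < s"
          using elim by force
        then show ?case
        proof cases
          case 1 then show ?thesis by simp
        next
          case 2
          then have "\<forall>\<^sub>F n in sequentially. f n < a \<bullet> p" using f order_tendstoD by blast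
          then show ?thesis
            by (intro tendsto_eventually, elim eventually_mono) (use 2 in auto)
        next
          case 3
          then have "\<forall>\<^sub>F n in sequentially. a \<bullet> p < f n" using f order_tendstoD by blast
          then show ?thesis
            by (intro tendsto_eventually, elim eventually_mono) (use 3 in auto)
        qed
      qed
    qed (auto split: split_indicator)
    ultimately show ?thesis unfolding upper_def by simp
  qed
  then show ?thesis
    unfolding continuous_at_sequentially by (auto simp: o_def)
qed

section \<open>The centroid\<close>

lemma integrable_moment: "integrable lborel (\<lambda>p. indicator C p * (a \<bullet> p - c))" for a :: 'a and c :: real
  using borel_integrable_compact[OF compact, of "\<lambda>p. a \<bullet> p - c"] by (simp add: continuous_intros)

definition centroid :: 'a where
  "centroid = (1 / volume) *\<^sub>R (\<integral>p. indicator C p *\<^sub>R p \<partial>lborel)"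

lemma integral_moment: "(\<integral>p. indicator C p * (a \<bullet> p - c) \<partial>lborel) = volume * (a \<bullet> centroid - c)"
proof -
  have int: "integrable lborel (\<lambda>p. indicator C p *\<^sub>R p)"
    using borel_integrable_compact[OF compact, of "\<lambda>p. p"] by simp
  have intC: "integrable lborel (\<lambda>p. indicator C p * c)"
    using emeasure_fin by simp
  have "(\<integral>p. indicator C p * (a \<bullet> p - c) \<partial>lborel) = (\<integral>p. a \<bullet> (indicator C p *\<^sub>R p) - indicator C p * c \<partial>lborel)"
    by (intro Bochner_Integration.integral_cong) (auto simp: algebra_simps)
  also have "\<dots> = a \<bullet> (\<integral>p. indicator C p *\<^sub>R p \<partial>lborel) - volume * c"
    using integral_inner_right[OF int, of a] integrable_inner_right[OF int, of a] intC
    by (subst Bochner_Integration.integral_diff) (simp_all del: inner_scaleR_right)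
  also have "\<dots> = volume * (a \<bullet> centroid - c)"
    using volume_pos by (simp add: centroid_def algebra_simps)
  finally show ?thesis .
qed

text \<open>If a hyperplane strictly separated the centroid from \<open>C\<close>, the moment about
  its level would be both nonnegative, as an integral over \<open>C\<close>, and negative, by the
  moment formula.\<close>

lemma centroid_in: "centroid \<in> C"
proof (rule ccontr)
  assume "centroid \<notin> C"
  then obtain a b where ab: "a \<bullet> centroid < b" "\<And>p. p \<in> C \<Longrightarrow> b < a \<bullet> p"
    using separating_hyperplane_closed_point[OF convex compact_imp_closed[OF compact]] by metis
  have "0 \<le> (\<integral>p. indicator C p * (a \<bullet> p - b) \<partial>lborel)"
    using ab(2) by (intro integral_nonneg_AE AE_I2) (auto split: split_indicator simp: less_imp_le)
  then show False
    using ab(1) volume_pos by (simp add: integral_moment zero_le_mult_iff)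
qed

lemma upper_minus:
  assumes "a \<noteq> 0"
  shows "upper (- a) (- s) = volume - upper a s"
proof -
  let ?A = "C \<inter> {p. s \<le> a \<bullet> p}" and ?B = "C \<inter> {p. - s \<le> - a \<bullet> p}"
  have "measure lborel (?A \<union> ?B) = measure lborel ?A + measure lborel ?B - measure lborel (?A \<inter> ?B)"
    by (rule measure_Un3) auto
  moreover have "?A \<union> ?B = C" "?A \<inter> ?B = C \<inter> {p. a \<bullet> p = s}" by auto
  ultimately show ?thesis using measure_hyperplane[OF assms, of s] by (simp add: upper_def)
qed

text \<open>The point \<open>q\<close> is a limit of interior points, so some ball in
  \<open>C\<close> lies strictly above level \<open>s\<close>.\<close>

lemma upper_pos:
  assumes q: "q \<in> C" "s < a \<bullet> q"
  shows "0 < upper a s"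
proof -
  have "q \<in> closure (interior C)"
    using convex_closure_interior[OF convex interior] q closure_subset by blast
  moreover have "open {p. s < a \<bullet> p}" by (rule open_halfspace_gt)
  ultimately have "{p. s < a \<bullet> p} \<inter> interior C \<noteq> {}"
    using q open_Int_closure_eq_empty[of "{p. s < a \<bullet> p}" "interior C"] by auto
  then obtain x where "x \<in> {p. s < a \<bullet> p} \<inter> interior C" by auto
  moreover have "open ({p. s < a \<bullet> p} \<inter> interior C)"
    by (intro open_Int open_halfspace_gt open_interior)
  ultimately obtain e where e: "0 < e" "ball x e \<subseteq> {p. s < a \<bullet> p} \<inter> interior C"
    by (meson open_contains_ball)
  then have "measure lborel (ball x e) \<le> upper a s"
    unfolding upper_def using interior_subset[of C] by (intro measure_mono_fmeasurable) fastforce+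
  with content_ball_pos[OF \<open>0 < e\<close>] show ?thesis by (rule less_le_trans)
qed

text \<open>Otherwise the nonnegative function \<open>M - a \<bullet> p\<close> would have integral
  zero over \<open>C\<close>, which would put almost all of \<open>C\<close> in one
  hyperplane.\<close>

lemma centroid_less_max:
  assumes "a \<noteq> 0" and q: "\<And>p. p \<in> C \<Longrightarrow> a \<bullet> p \<le> M"
  shows "a \<bullet> centroid < M"
proof (rule ccontr)
  assume "\<not> a \<bullet> centroid < M"
  with q[OF centroid_in] have "a \<bullet> centroid = M" by simp
  then have "(\<integral>p. indicator C p * (- a \<bullet> p - - M) \<partial>lborel) = 0"
    by (subst integral_moment) simp
  then have "AE p in lborel. indicator C p * (- a \<bullet> p - - M) = 0"
    by (subst (asm) integral_nonneg_eq_0_iff_AE[OF integrable_moment])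
       (use q in \<open>auto split: split_indicator\<close>)
  then have "AE p in lborel. p \<in> C \<longrightarrow> a \<bullet> p = M"
    by eventually_elim (auto split: split_indicator)
  moreover have "AE p in lborel. p \<notin> C \<inter> {p. a \<bullet> p = M}"
    by (rule AE_not_in) (use measure_hyperplane[OF assms(1)] fmeasurable_Int in \<open>auto simp: null_sets_def emeasure_eq_measure2\<close>)
  ultimately have "AE p in lborel. p \<notin> C"
    by eventually_elim auto
  then have "emeasure lborel C = 0"
    by (subst (asm) AE_iff_measurable[OF _ refl]) auto
  then show False using volume_pos by (simp add: measure_def)
qed

text \<open>When it decays, the log-concave tail lies below an exponential tail touching it at the
  centroid level. An exponential variable exceeds its mean with probability
  \<open>1 / exp 1\<close>, and the mean of \<open>a \<bullet> p\<close> is the centroid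
  level.\<close>

theorem gruenbaum:
  assumes a: "a \<noteq> 0"
  shows "volume / exp 1 \<le> upper a (a \<bullet> centroid)"
proof -
  have cont: "continuous_on C (\<lambda>p. a \<bullet> p)" by (intro continuous_intros)
  obtain qM where qM: "qM \<in> C" "\<And>p. p \<in> C \<Longrightarrow> a \<bullet> p \<le> a \<bullet> qM"
    using continuous_attains_sup[OF compact nonempty cont] by auto
  obtain qL where qL: "qL \<in> C" "\<And>p. p \<in> C \<Longrightarrow> a \<bullet> qL \<le> a \<bullet> p"
    using continuous_attains_inf[OF compact nonempty cont] by auto
  define M m where "M = a \<bullet> qM" and "m = a \<bullet> centroid"
  have mM: "m < M" unfolding m_def M_def using centroid_less_max[OF a qM(2)] by simp
  have pos: "0 < upper a s" if "s < M" for s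
    using upper_pos[OF qM(1)] that by (simp add: M_def)
  let ?g = "\<lambda>s. - ln (upper a s)"
  \<comment> \<open>Below the top level \<open>M\<close> the caps have positive volume, so the
    logarithm is meaningful.\<close>
  have "convex_on {..<M} ?g"
  proof (rule convex_on_midpoint_continuous)
    have "continuous_on {..<M} (upper a)"
      using continuous_upper[OF a] by (auto intro: continuous_at_imp_continuous_on)
    then show "continuous_on {..<M} ?g"
      using pos by (intro continuous_on_minus continuous_on_ln) (auto simp: less_imp_neq[symmetric])
    fix s t assume st: "s \<in> {..<M}" "t \<in> {..<M}"
    have "ln (upper a s * upper a t) \<le> ln ((upper a ((s + t) / 2))\<^sup>2)"
      using upper_midpoint pos[of s] pos[of t] pos[of "(s + t) / 2"] st by (subst ln_le_cancel_iff) auto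
    then show "?g ((s + t) / 2) \<le> (?g s + ?g t) / 2"
      using pos[of s] pos[of t] pos[of "(s + t) / 2"] st by (simp add: ln_mult ln_realpow)
  qed simp
  then obtain \<sigma> where \<sigma>: "\<And>s. s < M \<Longrightarrow> ?g m + \<sigma> * (s - m) \<le> ?g s"
    using convex_le_Inf_differential[of "{..<M}" ?g m] mM by (auto simp: interior_open)
  define b where "b = upper a m"
  have b: "0 < b" using pos mM by (simp add: b_def)
  show ?thesis
  proof (cases "\<sigma> \<le> 0")
    case True
    \<comment> \<open>With slope \<open>\<sigma> \<le> 0\<close>, the supporting line bounds the cap
      at the lowest level, which is all of \<open>C\<close>, by \<open>b\<close>.\<close>
    have L: "a \<bullet> qL \<le> m" unfolding m_def by (rule qL centroid_in)+
    have "0 \<le> \<sigma> * (a \<bullet> qL - m)" using True L by (intro mult_nonpos_nonpos) auto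
    then have "ln (upper a (a \<bullet> qL)) \<le> ln b" using \<sigma>[of "a \<bullet> qL"] L mM by (simp add: b_def)
    then have "upper a (a \<bullet> qL) \<le> b" using b pos[of "a \<bullet> qL"] L mM by simp
    moreover have "C \<inter> {p. a \<bullet> qL \<le> a \<bullet> p} = C" using qL by auto
    then have "upper a (a \<bullet> qL) = volume" by (simp add: upper_def)
    moreover have "volume / exp 1 \<le> volume" using volume_pos by (simp add: divide_le_eq)
    ultimately show ?thesis by (simp add: b_def m_def)
  next
    case False
    then have \<sigma>0: "0 < \<sigma>" by simp
    \<comment> \<open>The supporting line of \<open>ln \<circ> upper a\<close> at \<open>m\<close> says that \<open>a \<bullet> p\<close> is stochastically dominated by
      \<open>c\<close> plus an exponential variable of rate \<open>\<sigma>\<close>; comparing means gives \<open>m \<le> c + 1 / \<sigma>\<close>.\<close>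
    define c where "c = m - ln (volume / b) / \<sigma>"
    have tail: "upper a (c + t) \<le> volume * exp (- \<sigma> * t)" if "c + t < M" for t
    proof -
      have "ln (upper a (c + t)) \<le> ln b - \<sigma> * (c + t - m)" using \<sigma>[OF that] by (simp add: b_def)
      also have "\<dots> = ln (volume * exp (- \<sigma> * t))"
        using \<sigma>0 b volume_pos by (simp add: c_def ln_mult ln_div field_simps)
      finally show ?thesis using pos[OF that] volume_pos by simp
    qed
    let ?F = "\<lambda>p. indicator C p * (a \<bullet> p - c)"
    have "volume * (m - c) = (\<integral>p. ?F p \<partial>lborel)" by (simp add: integral_moment m_def)
    \<comment> \<open>Passing to the positive part allows the layer cake formula to express the
      bound through the tail.\<close>
    also have "\<dots> \<le> (\<integral>p. max 0 (?F p) \<partial>lborel)"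
      by (intro integral_mono integrable_moment integrable_max integrable_zero) auto
    finally have 1: "ennreal (volume * (m - c)) \<le> ennreal (\<integral>p. max 0 (?F p) \<partial>lborel)"
      by (rule ennreal_leI)
    have "ennreal (\<integral>p. max 0 (?F p) \<partial>lborel) = (\<integral>\<^sup>+p. ennreal (max 0 (?F p)) \<partial>lborel)"
      by (intro nn_integral_eq_integral[symmetric] integrable_max integrable_moment integrable_zero) auto
    also have "\<dots> = (\<integral>\<^sup>+t. emeasure lborel {p. ennreal t < ennreal (max 0 (?F p))} * indicator {0<..} t \<partial>lborel)"
      by (rule nn_integral_layer_cake) simp
    also have "\<dots> \<le> (\<integral>\<^sup>+t. ennreal (volume * exp (- \<sigma> * t)) * indicator {0..} t \<partial>lborel)"
    proof (rule nn_integral_mono)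
      fix t :: real
      show "emeasure lborel {p. ennreal t < ennreal (max 0 (?F p))} * indicator {0<..} t
          \<le> ennreal (volume * exp (- \<sigma> * t)) * indicator {0..} t"
      proof (cases "0 < t")
        case True
        then have sub: "{p. ennreal t < ennreal (max 0 (?F p))} \<subseteq> C \<inter> {p. c + t \<le> a \<bullet> p}"
            "{p. ennreal t < ennreal (max 0 (?F p))} \<subseteq> C \<inter> {p. c + t < a \<bullet> p}"
          by (auto simp: ennreal_less_iff split: split_indicator_asm)
        have "emeasure lborel {p. ennreal t < ennreal (max 0 (?F p))} \<le> ennreal (volume * exp (- \<sigma> * t))"
        proof (cases "c + t < M")
          case True
          have "emeasure lborel {p. ennreal t < ennreal (max 0 (?F p))} \<le> ennreal (upper a (c + t))"
            unfolding upper_ennreal by (rule emeasure_mono[OF sub(1)]) simp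
          also have "\<dots> \<le> ennreal (volume * exp (- \<sigma> * t))" using tail[OF True] by (rule ennreal_leI)
          finally show ?thesis .
        next
          case False
          \<comment> \<open>The strict inclusion is needed when \<open>c + t = M\<close>: the closed
            cap at level \<open>M\<close> still contains the top face of \<open>C\<close>.\<close>
          then have "{p. ennreal t < ennreal (max 0 (?F p))} = {}"
            using sub(2) qM(2) by (fastforce simp: M_def)
          then show ?thesis by simp
        qed
        then show ?thesis using True by simp
      qed (simp split: split_indicator)
    qed
    also have "\<dots> = ennreal (0 - - (volume / \<sigma>) * exp (- \<sigma> * 0))"
    proof (rule nn_integral_FTC_atLeast)
      show "((\<lambda>t. - (volume / \<sigma>) * exp (- \<sigma> * t)) \<longlongrightarrow> 0) at_top"
        using \<sigma>0 by real_asymp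
    qed (use \<sigma>0 volume_pos in \<open>auto intro!: derivative_eq_intros\<close>)
    finally have "ennreal (\<integral>p. max 0 (?F p) \<partial>lborel) \<le> ennreal (volume / \<sigma>)"
      by simp
    with 1 have "ennreal (volume * (m - c)) \<le> ennreal (volume / \<sigma>)"
      by (rule order_trans)
    then have "volume * (m - c) \<le> volume / \<sigma>"
      using \<sigma>0 volume_pos by (subst (asm) ennreal_le_iff) auto
    \<comment> \<open>By the choice of \<open>c\<close>, \<open>m - c\<close> is
      \<open>ln (volume / b) / \<sigma>\<close>, so the rate cancels.\<close>
    then have "ln (volume / b) \<le> 1"
      using \<sigma>0 volume_pos by (simp add: c_def field_simps)
    then have "volume / b \<le> exp 1"
      using b volume_pos by (metis divide_pos_pos exp_le_cancel_iff exp_ln)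
    then show ?thesis using b by (simp add: b_def m_def field_simps)
  qed
qed

section \<open>Volumes of slabs\<close>

text \<open>Contracting towards \<open>q\<close> keeps \<open>C\<close> inside itself and shifts
  levels affinely, so the image of one cap fits into another.\<close>

lemma upper_homothety:
  assumes q: "q \<in> C" and \<mu>: "0 \<le> \<mu>" "\<mu> < 1"
  shows "(1 - \<mu>) ^ DIM('a) * upper a s \<le> upper a ((1 - \<mu>) * s + \<mu> * (a \<bullet> q))"
proof -
  have "ennreal ((1 - \<mu>) ^ DIM('a)) * emeasure lborel (C \<inter> {p. s \<le> a \<bullet> p})
     \<le> emeasure lborel (C \<inter> {p. (1 - \<mu>) * s + \<mu> * (a \<bullet> q) \<le> a \<bullet> p})"
  proof (rule emeasure_lborel_homothety_le[where t = "\<mu> *\<^sub>R q"])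
    fix p assume "p \<in> C \<inter> {p. s \<le> a \<bullet> p}"
    then show "\<mu> *\<^sub>R q + (1 - \<mu>) *\<^sub>R p \<in> C \<inter> {p. (1 - \<mu>) * s + \<mu> * (a \<bullet> q) \<le> a \<bullet> p}"
      using convexD[OF convex q, of p \<mu> "1 - \<mu>"] \<mu> by (auto simp: inner_add_right intro: mult_left_mono)
  qed (use \<mu> in auto)
  then show ?thesis
    using \<mu> by (simp flip: upper_ennreal add: ennreal_mult'[symmetric])
qed

text \<open>The cap at level \<open>s\<close> is contracted towards \<open>q\<close> into the cap at
  level \<open>s + \<tau>\<close>; Bernoulli's inequality bounds the volume lost.\<close>

lemma slab_one_sided:
  fixes \<tau> :: real
  assumes q: "q \<in> C" and \<tau>: "0 \<le> \<tau>"
  shows "(upper a s - upper a (s + \<tau>)) * (a \<bullet> q - s) \<le> DIM('a) * \<tau> * volume"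
proof (cases "a \<bullet> q - s \<le> \<tau>")
  case True
  \<comment> \<open>Here \<open>q\<close> is at most \<open>\<tau>\<close> above level
    \<open>s\<close>, and bounding the slab by the whole body suffices.\<close>
  have "upper a s - upper a (s + \<tau>) \<le> volume"
    using upper_le_volume[of a s] upper_nonneg[of a "s + \<tau>"] by linarith
  moreover have "0 \<le> upper a s - upper a (s + \<tau>)" using upper_antimono[of s "s + \<tau>" a] \<tau> by simp
  ultimately have "(upper a s - upper a (s + \<tau>)) * (a \<bullet> q - s) \<le> volume * \<tau>"
    using True \<tau> volume_pos
    by (meson less_imp_le mult_left_mono mult_right_mono order_trans)
  also have "\<dots> \<le> DIM('a) * (volume * \<tau>)"
    using DIM_positive[where 'a = 'a] volume_pos \<tau> mult_right_mono[of 1 "real DIM('a)" "volume * \<tau>"] by simp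
  finally show ?thesis by (simp add: ac_simps)
next
  case False
  \<comment> \<open>This contraction moves level \<open>s\<close> exactly to
    \<open>s + \<tau>\<close>.\<close>
  define \<mu> where "\<mu> = \<tau> / (a \<bullet> q - s)"
  have \<mu>: "0 \<le> \<mu>" "\<mu> < 1" "\<mu> * (a \<bullet> q - s) = \<tau>" using False \<tau> by (auto simp: \<mu>_def)
  have "(1 - \<mu>) * s + \<mu> * (a \<bullet> q) = s + \<tau>" using \<mu>(3) by (simp add: algebra_simps)
  then have "(1 - \<mu>) ^ DIM('a) * upper a s \<le> upper a (s + \<tau>)"
    using upper_homothety[OF q \<mu>(1,2), of a s] by simp
  moreover have "1 - DIM('a) * \<mu> \<le> (1 - \<mu>) ^ DIM('a)"
    using Bernoulli_inequality[of "- \<mu>" "DIM('a)"] \<mu> by simp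
  then have "(1 - DIM('a) * \<mu>) * upper a s \<le> (1 - \<mu>) ^ DIM('a) * upper a s"
    by (intro mult_right_mono) auto
  ultimately have "upper a s - upper a (s + \<tau>) \<le> DIM('a) * \<mu> * upper a s"
    by (simp add: algebra_simps)
  also have "\<dots> \<le> DIM('a) * \<mu> * volume"
    using \<mu> upper_le_volume by (intro mult_left_mono) auto
  finally have "(upper a s - upper a (s + \<tau>)) * (a \<bullet> q - s) \<le> DIM('a) * \<mu> * volume * (a \<bullet> q - s)"
    using False \<tau> by (intro mult_right_mono) auto
  also have "\<dots> = DIM('a) * (\<mu> * (a \<bullet> q - s)) * volume" by (simp only: ac_simps)
  also have "\<dots> = DIM('a) * \<tau> * volume" by (simp only: \<mu>(3))
  finally show ?thesis .
qed

text \<open>The bound of \<open>slab_one_sided\<close> from the top point \<open>q\<close> and, for \<open>- a\<close>, from the bottom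
  point \<open>r\<close> are added, so that the width of the body appears.\<close>

lemma slab:
  fixes \<tau> :: real
  assumes a: "a \<noteq> 0" and q: "q \<in> C" "r \<in> C" and \<tau>: "0 \<le> \<tau>"
  shows "(upper a s - upper a (s + \<tau>)) * (a \<bullet> (q - r)) \<le> 2 * DIM('a) * \<tau> * volume"
proof -
  let ?D = "upper a s - upper a (s + \<tau>)"
  have D: "upper (- a) (- (s + \<tau>)) - upper (- a) (- (s + \<tau>) + \<tau>) = ?D"
    using upper_minus[OF a, of s] upper_minus[OF a, of "s + \<tau>"] by simp
  have "- a \<bullet> r - - (s + \<tau>) = s + \<tau> - a \<bullet> r" by simp
  from slab_one_sided[OF q(2) \<tau>, of "- a" "- (s + \<tau>)", unfolded D this]
  have "?D * (s + \<tau> - a \<bullet> r) \<le> DIM('a) * \<tau> * volume" .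
  moreover have "?D * (a \<bullet> q - s) \<le> DIM('a) * \<tau> * volume"
    by (rule slab_one_sided[OF q(1) \<tau>])
  \<comment> \<open>The reflected bound starts from level \<open>s + \<tau>\<close>, so the two
    distances add up to the width plus \<open>\<tau>\<close>; the surplus is dropped.\<close>
  moreover have "0 \<le> ?D * \<tau>" using upper_antimono[of s "s + \<tau>" a] \<tau> by simp
  ultimately show ?thesis by (simp add: algebra_simps inner_diff_right)
qed

end

section \<open>Rounding to the integer lattice\<close>

definition lattice_round :: "real ^ 'n \<Rightarrow> real ^ 'n" where
  "lattice_round w = (\<chi> i. of_int (round (w $ i)))"

lemma lattice_round_in: "lattice_round w \<in> integer_points"
  by (simp add: lattice_round_def integer_points_def)

lemma infnorm_cart_le:
  fixes u :: "real ^ 'n"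
  assumes "\<And>i. \<bar>u $ i\<bar> \<le> c"
  shows "infnorm u \<le> c"
  unfolding infnorm_cart by (rule cSup_least) (use assms in auto)

text \<open>Rounding moves each coordinate by at most one half. Magnified by \<open>2 * k\<close>,
  the displacement is an admissible offset within the cube of half-width \<open>k\<close>.\<close>

lemma infnorm_lattice_round:
  assumes "0 < k"
  shows "infnorm ((2 * k) *\<^sub>R (lattice_round w - w)) \<le> k" "infnorm ((2 * k) *\<^sub>R (w - lattice_round w)) \<le> k"
proof -
  have "infnorm (lattice_round w - w) \<le> 1 / 2"
    by (rule infnorm_cart_le) (use of_int_round_abs_le in \<open>auto simp: lattice_round_def\<close>)
  then have "(2 * k) * infnorm (lattice_round w - w) \<le> (2 * k) * (1 / 2)"
    using assms by (intro mult_left_mono) auto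
  then show "infnorm ((2 * k) *\<^sub>R (lattice_round w - w)) \<le> k"
    using assms by (simp add: infnorm_mul)
  then show "infnorm ((2 * k) *\<^sub>R (w - lattice_round w)) \<le> k"
    by (simp add: infnorm_mul infnorm_sub)
qed

lemma measurable_lattice_round [measurable]: "(lattice_round :: real ^ 'n \<Rightarrow> _) \<in> borel_measurable borel"
proof -
  have "(\<lambda>w. lattice_round w \<bullet> b) \<in> borel_measurable borel" if "b \<in> Basis" for b :: "real ^ 'n"
  proof -
    obtain i where i: "b = axis i 1" using \<open>b \<in> Basis\<close> by (auto simp: Basis_vec_def)
    have "(\<lambda>w. real_of_int \<lfloor>w \<bullet> b + 1 / 2\<rfloor>) \<in> borel_measurable borel"
      by measurable
    then show ?thesis by (simp add: lattice_round_def i inner_axis round_def)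
  qed
  then show ?thesis by (subst borel_measurable_euclidean_space) blast
qed

text \<open>The cell is a half-open unit cube around \<open>z\<close>, squeezed between the open and
  the closed cube.\<close>

lemma emeasure_lattice_round_cell:
  fixes z :: "real ^ 'n"
  assumes z: "z \<in> integer_points"
  shows "emeasure lborel {w. lattice_round w = z} = 1"
proof -
  let ?h = "(\<chi> i. 1 / 2) :: real ^ 'n"
  let ?R = "{w. lattice_round w = z}"
  have R: "w \<in> ?R \<longleftrightarrow> (\<forall>i. z $ i - 1 / 2 \<le> w $ i \<and> w $ i < z $ i + 1 / 2)" for w
  proof -
    have "real_of_int (round (w $ i)) = z $ i \<longleftrightarrow> z $ i - 1 / 2 \<le> w $ i \<and> w $ i < z $ i + 1 / 2" for i
    proof -
      obtain j where j: "z $ i = of_int j" using z by (auto simp: integer_points_def elim: Ints_cases)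
      show ?thesis unfolding j round_def of_int_eq_iff floor_eq_iff by auto
    qed
    then show ?thesis by (auto simp: lattice_round_def vec_eq_iff)
  qed
  have [measurable]: "?R \<in> sets borel" by measurable
  have Basis: "(z + ?h - (z - ?h)) \<bullet> b = 1" if "b \<in> Basis" for b
    using that by (auto simp: Basis_vec_def inner_axis)
  have le: "(z - ?h) \<bullet> b \<le> (z + ?h) \<bullet> b" if "b \<in> Basis" for b
    using that by (auto simp: Basis_vec_def inner_axis)
  have "box (z - ?h) (z + ?h) \<subseteq> ?R"
    unfolding subset_iff R by (simp add: mem_box_cart less_imp_le)
  then have "emeasure lborel (box (z - ?h) (z + ?h)) \<le> emeasure lborel ?R"
    by (rule emeasure_mono) simp
  moreover have "?R \<subseteq> cbox (z - ?h) (z + ?h)"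
    unfolding subset_iff R by (simp add: mem_box_cart less_imp_le)
  then have "emeasure lborel ?R \<le> emeasure lborel (cbox (z - ?h) (z + ?h))"
    by (rule emeasure_mono) simp
  ultimately show ?thesis
    using emeasure_lborel_box[OF le] emeasure_lborel_cbox[OF le] Basis by (simp add: le antisym)
qed

lemma finite_integer_points_bounded:
  assumes "bounded (B :: (real ^ 'n) set)"
  shows "finite (integer_points \<inter> B)"
proof -
  obtain b where b: "\<And>z. z \<in> B \<Longrightarrow> norm z \<le> b" using assms by (auto simp: bounded_iff)
  have "integer_points \<inter> B \<subseteq> (\<lambda>f. \<chi> i. of_int (f i)) ` (PiE UNIV (\<lambda>_. {- \<lceil>b\<rceil>..\<lceil>b\<rceil>}))"
  proof
    fix z assume z: "z \<in> integer_points \<inter> B"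
    have "z = (\<chi> i. of_int \<lfloor>z $ i\<rfloor>)"
      using z by (auto simp: integer_points_def vec_eq_iff)
    moreover have "\<lfloor>z $ i\<rfloor> \<in> {- \<lceil>b\<rceil>..\<lceil>b\<rceil>}" for i
    proof -
      have "\<bar>z $ i\<bar> \<le> b" using component_le_norm_cart[of z i] b[of z] z by simp
      then show ?thesis by (auto simp: le_floor_iff floor_le_iff; linarith)
    qed
    ultimately show "z \<in> (\<lambda>f. \<chi> i. of_int (f i)) ` (PiE UNIV (\<lambda>_. {- \<lceil>b\<rceil>..\<lceil>b\<rceil>}))"
      by (intro image_eqI[where x = "\<lambda>i. \<lfloor>z $ i\<rfloor>"]) auto
  qed
  then show ?thesis by (rule finite_subset) (intro finite_imageI finite_PiE; simp)
qed

section \<open>Fibers, mixed-integer volume and Lebesgue volume\<close>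

abbreviation fiber_volume :: "('a \<times> 'b::euclidean_space) set \<Rightarrow> 'a \<Rightarrow> ennreal" where
  "fiber_volume E z \<equiv> emeasure lborel (Pair z -` E)"

lemma measurable_fiber_volume:
  fixes E :: "('a::euclidean_space \<times> 'b::euclidean_space) set"
  assumes "E \<in> sets borel"
  shows "fiber_volume E \<in> borel_measurable borel"
  using lborel.measurable_emeasure_Pair[of E borel] assms
  by (simp add: borel_prod sets_lborel cong: sets_pair_measure_cong)

lemma emeasure_eq_nn_integral_fiber:
  fixes E :: "('a::euclidean_space \<times> 'b::euclidean_space) set"
  assumes "E \<in> sets borel"
  shows "emeasure lborel E = (\<integral>\<^sup>+z. fiber_volume E z \<partial>lborel)"
proof -
  have "E \<in> sets (lborel \<Otimes>\<^sub>M lborel)" unfolding lborel_prod using assms by simp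
  from lborel.emeasure_pair_measure_alt[OF this] show ?thesis by (simp add: lborel_prod)
qed

lemma compact_vimage_Pair:
  fixes E :: "('a::euclidean_space \<times> 'b::euclidean_space) set"
  assumes "compact E"
  shows "Pair z -` E \<in> sets borel"
  by (rule borel_closed, rule closed_vimage) (use assms in \<open>auto simp: compact_imp_closed intro!: continuous_intros\<close>)

text \<open>Rounding is constant on cells of volume 1, so the sum over integer points is the
  integral of a step function. In this form it can be compared with the Lebesgue volume fiber by
  fiber, after an affine substitution.\<close>

lemma mixed_integer_volume_eq:
  fixes E :: "((real ^ 'n) \<times> (real ^ 'd)) set"
  assumes "compact E"
  shows "mixed_integer_volume (E \<inter> (integer_points \<times> UNIV)) = (\<integral>\<^sup>+w. fiber_volume E (lattice_round w) \<partial>lborel)"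
proof -
  \<comment> \<open>By compactness only finitely many integer points carry a nonempty fiber, which
    makes the infinite sum finite.\<close>
  let ?Z = "integer_points \<inter> fst ` E"
  have fin: "finite ?Z"
    by (intro finite_integer_points_bounded compact_imp_bounded compact_continuous_image assms continuous_intros)
  have zero: "fiber_volume E z = 0" if "z \<notin> fst ` E" for z
  proof -
    have "Pair z -` E = {}" using that by force
    then show ?thesis by simp
  qed
  have "mixed_integer_volume (E \<inter> (integer_points \<times> UNIV)) = (\<Sum>\<^sub>\<infinity>z\<in>?Z. fiber_volume E z)"
    unfolding mixed_integer_volume_def
  proof (rule infsum_cong_neutral)
    fix z :: "real ^ 'n" assume "z \<in> integer_points - ?Z"
    then show "emeasure lebesgue {x. (z, x) \<in> E \<inter> (integer_points \<times> UNIV)} = 0"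
      by (auto intro: emeasure_eq_0 simp: image_iff) (metis (no_types, lifting) Collect_empty_eq emeasure_empty fst_conv)
  next
    fix z :: "real ^ 'n" assume "z \<in> integer_points \<inter> ?Z"
    then have "{x. (z, x) \<in> E \<inter> (integer_points \<times> UNIV)} = Pair z -` E" by auto
    then show "emeasure lebesgue {x. (z, x) \<in> E \<inter> (integer_points \<times> UNIV)} = fiber_volume E z"
      using compact_vimage_Pair[OF assms] by simp
  qed auto
  also have "\<dots> = (\<Sum>z\<in>?Z. fiber_volume E z)" using fin by simp
  also have "\<dots> = (\<Sum>z\<in>?Z. \<integral>\<^sup>+w. fiber_volume E z * indicator {w. lattice_round w = z} w \<partial>lborel)"
    by (intro sum.cong refl) (simp add: nn_integral_cmult_indicator emeasure_lattice_round_cell)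
  also have "\<dots> = (\<integral>\<^sup>+w. (\<Sum>z\<in>?Z. fiber_volume E z * indicator {w. lattice_round w = z} w) \<partial>lborel)"
    by (rule nn_integral_sum[symmetric]) measurable
  also have "\<dots> = (\<integral>\<^sup>+w. fiber_volume E (lattice_round w) \<partial>lborel)"
  proof (rule nn_integral_cong)
    fix w :: "real ^ 'n"
    have "(\<Sum>z\<in>?Z. fiber_volume E z * indicator {w. lattice_round w = z} w)
        = (\<Sum>z\<in>?Z. if z = lattice_round w then fiber_volume E z else 0)"
      by (intro sum.cong refl) (auto split: split_indicator)
    also have "\<dots> = fiber_volume E (lattice_round w)"
      using fin zero lattice_round_in by (auto simp: sum.delta)
    finally show "(\<Sum>z\<in>?Z. fiber_volume E z * indicator {w. lattice_round w = z} w) = fiber_volume E (lattice_round w)" .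
  qed
  finally show ?thesis .
qed

lemma fiber_volume_homothety_le:
  fixes E F :: "('a::euclidean_space \<times> 'b::euclidean_space) set"
  assumes "compact E" "compact F" "0 < c"
    and "\<And>x. (w, x) \<in> E \<Longrightarrow> (z, t + c *\<^sub>R x) \<in> F"
  shows "ennreal (c ^ DIM('b)) * fiber_volume E w \<le> fiber_volume F z"
  by (rule emeasure_lborel_homothety_le[where t = t]) (use assms compact_vimage_Pair in auto)

text \<open>The fiber of \<open>E\<close> over \<open>w\<close> is contracted into the fiber of
  \<open>F\<close> over a nearby integer point. Fibers lose the factor for the \<open>'d\<close>
  coordinates, the substitution in \<open>w\<close> the one for the \<open>'n\<close> coordinates.
  Separate sets \<open>E\<close> and \<open>F\<close> allow a deeper cap to be sent into a given
  halfspace.\<close>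

lemma mixed_integer_volume_ge:
  fixes E F :: "((real ^ 'n) \<times> (real ^ 'd)) set"
  assumes E: "compact E" and F: "compact F" and k: "1 / 2 < k"
    and lift: "\<And>u. infnorm u \<le> k \<Longrightarrow> \<exists>r. \<forall>p\<in>E. (1 - 1 / (2 * k)) *\<^sub>R p + (1 / (2 * k)) *\<^sub>R (z0 + u, r) \<in> F"
  shows "ennreal ((1 - 1 / (2 * k)) ^ (CARD('n) + CARD('d))) * emeasure lborel E
      \<le> mixed_integer_volume (F \<inter> (integer_points \<times> UNIV))"
proof -
  define \<kappa> where "\<kappa> = 1 / (2 * k)"
  have \<kappa>: "0 < \<kappa>" "0 < 1 - \<kappa>" "\<kappa> * (2 * k) = 1" using k by (auto simp: \<kappa>_def field_simps)
  have Eb: "E \<in> sets borel" and Fb: "F \<in> sets borel" using E F by (auto simp: borel_compact)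
  note [measurable] = measurable_fiber_volume[OF Eb] measurable_fiber_volume[OF Fb]
  have fib: "ennreal ((1 - \<kappa>) ^ CARD('d)) * fiber_volume E w
      \<le> fiber_volume F (lattice_round (\<kappa> *\<^sub>R z0 + (1 - \<kappa>) *\<^sub>R w))" for w
  proof -
    let ?v = "\<kappa> *\<^sub>R z0 + (1 - \<kappa>) *\<^sub>R w"
    \<comment> \<open>Since \<open>\<kappa> * (2 * k) = 1\<close>, contracting towards a point over
      \<open>z0 + u\<close> instead of \<open>z0\<close> adds exactly the rounding
      displacement.\<close>
    define u where "u = (2 * k) *\<^sub>R (lattice_round ?v - ?v)"
    have "infnorm u \<le> k" unfolding u_def using k by (intro infnorm_lattice_round) auto
    then obtain r where r: "\<And>p. p \<in> E \<Longrightarrow> (1 - \<kappa>) *\<^sub>R p + \<kappa> *\<^sub>R (z0 + u, r) \<in> F"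
      using lift unfolding \<kappa>_def by blast
    have "\<kappa> *\<^sub>R u = lattice_round ?v - ?v" using \<kappa>(3) by (simp add: u_def)
    then have "(1 - \<kappa>) *\<^sub>R w + \<kappa> *\<^sub>R (z0 + u) = lattice_round ?v"
      by (simp add: scaleR_add_right)
    with r have "(lattice_round ?v, \<kappa> *\<^sub>R r + (1 - \<kappa>) *\<^sub>R x) \<in> F" if "(w, x) \<in> E" for x
      using that by (fastforce simp: add.commute)
    then show ?thesis
      using fiber_volume_homothety_le[OF E F \<kappa>(2), of w "lattice_round ?v" "\<kappa> *\<^sub>R r"] by simp
  qed
  have "ennreal ((1 - \<kappa>) ^ (CARD('n) + CARD('d))) * emeasure lborel E
      = ennreal ((1 - \<kappa>) ^ CARD('n)) * (\<integral>\<^sup>+w. ennreal ((1 - \<kappa>) ^ CARD('d)) * fiber_volume E w \<partial>lborel)"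
    using \<kappa> by (simp add: emeasure_eq_nn_integral_fiber[OF Eb] nn_integral_cmult power_add ennreal_mult' mult.assoc)
  also have "\<dots> \<le> ennreal ((1 - \<kappa>) ^ CARD('n)) * (\<integral>\<^sup>+w. fiber_volume F (lattice_round (\<kappa> *\<^sub>R z0 + (1 - \<kappa>) *\<^sub>R w)) \<partial>lborel)"
    by (intro mult_left_mono nn_integral_mono fib) auto
  also have "\<dots> = (\<integral>\<^sup>+w. fiber_volume F (lattice_round w) \<partial>lborel)"
    using nn_integral_lborel_affine[of "\<lambda>w. fiber_volume F (lattice_round w)" "1 - \<kappa>" "\<kappa> *\<^sub>R z0"] \<kappa> by simp
  finally show ?thesis by (simp add: mixed_integer_volume_eq[OF F] \<kappa>_def)
qed

text \<open>The opposite comparison: fibers over integer points are contracted into fibers over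
  points that run through the whole space as \<open>w\<close> varies.\<close>

lemma mixed_integer_volume_le:
  fixes C :: "((real ^ 'n) \<times> (real ^ 'd)) set"
  assumes C: "compact C" "convex C" and k: "0 < k"
    and lift: "\<And>u. infnorm u \<le> k \<Longrightarrow> \<exists>r. (z0 + u, r) \<in> C"
  shows "mixed_integer_volume (C \<inter> (integer_points \<times> UNIV))
      \<le> ennreal ((1 + 1 / (2 * k)) ^ (CARD('n) + CARD('d))) * emeasure lborel C"
proof -
  \<comment> \<open>The solution of \<open>\<mu> = (1 - \<mu>) * (2 * k)\<close>, for which an
    offset \<open>u\<close> within the cube cancels the rounding error of \<open>w\<close>. Its
    inverse is the factor in the claim.\<close>
  define \<mu> where "\<mu> = 2 * k / (2 * k + 1)"
  have \<mu>: "0 < \<mu>" "0 < 1 - \<mu>" "\<mu> = (1 - \<mu>) * (2 * k)" "\<mu> * (1 + 1 / (2 * k)) = 1"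
    using k add_pos_pos[of "k * 2" "k * (k * 4)"] by (auto simp: \<mu>_def field_simps)
  have Cb: "C \<in> sets borel" using C by (auto simp: borel_compact)
  note [measurable] = measurable_fiber_volume[OF Cb]
  have fib: "ennreal (\<mu> ^ CARD('d)) * fiber_volume C (lattice_round w)
      \<le> fiber_volume C ((1 - \<mu>) *\<^sub>R z0 + \<mu> *\<^sub>R w)" for w
  proof -
    define u where "u = (2 * k) *\<^sub>R (w - lattice_round w)"
    have "infnorm u \<le> k" unfolding u_def using k by (rule infnorm_lattice_round)
    then obtain r where r: "(z0 + u, r) \<in> C" using lift by blast
    have "(1 - \<mu>) *\<^sub>R u = \<mu> *\<^sub>R (w - lattice_round w)"
      using \<mu>(3) by (simp add: u_def)
    then have eq: "(1 - \<mu>) *\<^sub>R (z0 + u) + \<mu> *\<^sub>R lattice_round w = (1 - \<mu>) *\<^sub>R z0 + \<mu> *\<^sub>R w"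
      by (simp add: scaleR_add_right scaleR_diff_right)
    have "((1 - \<mu>) *\<^sub>R z0 + \<mu> *\<^sub>R w, (1 - \<mu>) *\<^sub>R r + \<mu> *\<^sub>R x) \<in> C" if "(lattice_round w, x) \<in> C" for x
      using convexD[OF C(2) r that, of "1 - \<mu>" \<mu>] \<mu> unfolding eq[symmetric] by simp
    then show ?thesis
      using fiber_volume_homothety_le[OF C(1) C(1) \<mu>(1), of "lattice_round w" _ "(1 - \<mu>) *\<^sub>R r"] by simp
  qed
  have "ennreal (\<mu> ^ (CARD('n) + CARD('d))) * mixed_integer_volume (C \<inter> (integer_points \<times> UNIV))
     = ennreal (\<mu> ^ CARD('n)) * (\<integral>\<^sup>+w. ennreal (\<mu> ^ CARD('d)) * fiber_volume C (lattice_round w) \<partial>lborel)"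
    using \<mu> by (simp add: mixed_integer_volume_eq[OF C(1)] nn_integral_cmult power_add ennreal_mult' mult.assoc)
  also have "\<dots> \<le> ennreal (\<mu> ^ CARD('n)) * (\<integral>\<^sup>+w. fiber_volume C ((1 - \<mu>) *\<^sub>R z0 + \<mu> *\<^sub>R w) \<partial>lborel)"
    by (intro mult_left_mono nn_integral_mono fib) auto
  also have "\<dots> = emeasure lborel C"
    using nn_integral_lborel_affine[of "fiber_volume C" \<mu> "(1 - \<mu>) *\<^sub>R z0"] \<mu>
    by (simp add: emeasure_eq_nn_integral_fiber[OF Cb])
  finally have "ennreal ((1 + 1 / (2 * k)) ^ (CARD('n) + CARD('d))) *
      (ennreal (\<mu> ^ (CARD('n) + CARD('d))) * mixed_integer_volume (C \<inter> (integer_points \<times> UNIV)))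
     \<le> ennreal ((1 + 1 / (2 * k)) ^ (CARD('n) + CARD('d))) * emeasure lborel C"
    by (intro mult_left_mono) auto
  moreover have "ennreal ((1 + 1 / (2 * k)) ^ (CARD('n) + CARD('d))) * ennreal (\<mu> ^ (CARD('n) + CARD('d))) = 1"
    using k \<mu> by (simp add: ennreal_mult'[symmetric] power_mult_distrib[symmetric] mult.commute)
  ultimately show ?thesis by (simp add: mult.assoc[symmetric])
qed

section \<open>The centerpoint\<close>

text \<open>With \<open>x = N * \<kappa>\<close>, Bernoulli gives \<open>1 - x\<close> as a lower
  bound for \<open>(1 - \<kappa>) ^ N\<close> and its inverse as an upper bound for
  \<open>(1 + \<kappa>) ^ N\<close>. What remains is a quadratic inequality in \<open>x\<close>,
  which follows from \<open>2 * e \<le> 1\<close>.\<close>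

lemma rounding_loss:
  fixes \<kappa> :: real
  assumes \<kappa>: "0 < \<kappa>" "\<kappa> < 1" and N: "1 \<le> N" and small: "3 * (real N * \<kappa>) \<le> 1 / exp 1"
  shows "(1 / exp 1 - 3 * (real N * \<kappa>)) * (1 + \<kappa>) ^ N
     \<le> (1 - \<kappa>) ^ N * (1 / exp 1 - 2 * (real N * \<kappa>) / (1 - \<kappa>))"
proof -
  define x e A where "x = real N * \<kappa>" and "e = 1 / exp (1 :: real)" and "A = (1 + \<kappa>) ^ N"
  have e: "0 < e" "2 * e \<le> 1" using exp_ge_add_one_self[of 1] by (auto simp: e_def)
  have x: "0 \<le> x" "3 * x \<le> e" using \<kappa> small by (auto simp: x_def e_def)
  have bern: "1 - x \<le> (1 - \<kappa>) ^ N"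
    using Bernoulli_inequality[of "- \<kappa>" N] \<kappa> by (simp add: x_def)
  have A: "0 \<le> A" "A * (1 - x) \<le> 1"
  proof -
    have "A * (1 - x) \<le> A * (1 - \<kappa>) ^ N" using bern \<kappa> by (intro mult_left_mono) (auto simp: A_def)
    also have "\<dots> = (1 - \<kappa>\<^sup>2) ^ N"
      by (simp add: A_def power_mult_distrib[symmetric] power2_eq_square algebra_simps)
    also have "\<dots> \<le> 1" using \<kappa> by (intro power_le_one) (auto simp: power_le_one)
    finally show "A * (1 - x) \<le> 1" .
  qed (use \<kappa> in \<open>simp add: A_def\<close>)
  have xe: "x * e \<le> x" "0 \<le> x * e" "2 * (x * e) \<le> x" using x e mult_left_mono[of e 1 x] mult_left_mono[of "2*e" 1 x] by auto
  have "((1 - x) * e - 2 * x) * (1 - x) = e - 2 * (x * e) - 2 * x + e * x\<^sup>2 + 2 * x\<^sup>2"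
    by (simp add: power2_eq_square algebra_simps)
  moreover have "0 \<le> e * x\<^sup>2" "0 \<le> x\<^sup>2" using e by auto
  ultimately have "(e - 3 * x) \<le> ((1 - x) * e - 2 * x) * (1 - x)"
    using xe by linarith
  then have "(e - 3 * x) * A \<le> ((1 - x) * e - 2 * x) * (1 - x) * A"
    using A by (intro mult_right_mono) auto
  also have "\<dots> = ((1 - x) * e - 2 * x) * (A * (1 - x))" by simp
  also have "\<dots> \<le> ((1 - x) * e - 2 * x) * 1"
    using A xe x by (intro mult_left_mono) (auto simp: algebra_simps)
  \<comment> \<open>One of the \<open>N\<close> factors cancels the denominator
    \<open>1 - \<kappa>\<close>, hence the exponent \<open>N - 1\<close>.\<close>
  also have "\<dots> \<le> (1 - \<kappa>) ^ N * e - 2 * x * (1 - \<kappa>) ^ (N - 1)"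
  proof -
    have "2 * x * (1 - \<kappa>) ^ (N - 1) \<le> 2 * x * 1"
      using x \<kappa> by (intro mult_left_mono power_le_one) auto
    moreover have "(1 - x) * e \<le> (1 - \<kappa>) ^ N * e" using bern e by (intro mult_right_mono) auto
    ultimately show ?thesis by simp
  qed
  also have "\<dots> = (1 - \<kappa>) ^ N * (e - 2 * x / (1 - \<kappa>))"
    using N \<kappa> by (cases N) (auto simp: field_simps)
  finally show ?thesis by (simp add: x_def e_def A_def)
qed

theorem theorem2p4:
  fixes C S :: "((real ^ 'n) \<times> (real ^ 'd)) set"
    and K :: "(real ^ 'n) set"
    and z0 :: "real ^ 'n"
    and k :: real
  assumes "convex_body C"
    and "S = C \<inter> (integer_points \<times> UNIV)"
    and "K = fst ` C"
    and "k > 0"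
    and "(\<lambda>u. z0 + k *\<^sub>R u) ` unit_ball_infty \<subseteq> K"
    and "k \<ge> 3 * exp 1 / 2 * (real CARD('n) + real CARD('d))"
  shows "\<exists>y\<in>S. \<forall>H. closed_halfspace H \<and> y \<in> H \<longrightarrow>
           mixed_integer_volume (S \<inter> H)
             \<ge> ennreal (1 / exp 1 - 3 * (real CARD('n) + real CARD('d)) / (2 * k))
                 * mixed_integer_volume S"
proof -
  interpret euclidean_convex_body C by standard (rule assms)
  define N where "N = CARD('n) + CARD('d)"
  define \<kappa> where "\<kappa> = 1 / (2 * k)"
  have N: "1 \<le> N" by (simp_all add: N_def Suc_le_eq)
  have lift: "\<exists>r. (z0 + u, r) \<in> C" if "infnorm u \<le> k" for u
  proof -
    have "(1 / k) *\<^sub>R u \<in> unit_ball_infty"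
      using that \<open>k > 0\<close> by (simp add: unit_ball_infty_def infnorm_mul)
    then have "z0 + k *\<^sub>R ((1 / k) *\<^sub>R u) \<in> K" using assms(5) by blast
    then show ?thesis using \<open>k > 0\<close> assms(3) by auto
  qed
  have small: "3 * (real N * \<kappa>) \<le> 1 / exp 1"
    using assms(4,6) by (simp add: N_def \<kappa>_def field_simps)
  have k: "1 / 2 < k"
  proof -
    have "1 * 1 \<le> exp 1 * real N" using N by (intro mult_mono) auto
    then show ?thesis using assms(6) by (simp add: N_def algebra_simps)
  qed
  have \<kappa>: "0 < \<kappa>" "\<kappa> < 1" "\<kappa> * (2 * k) = 1" using k by (auto simp: \<kappa>_def field_simps)
  \<comment> \<open>Contracting the centroid towards a point over \<open>z0\<close> lands over
    \<open>v\<close>; the offset \<open>u\<close> moves the landing point to the integer point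
    \<open>z\<close>.\<close>
  define v z u where "v = (1 - \<kappa>) *\<^sub>R fst centroid + \<kappa> *\<^sub>R z0" and "z = lattice_round v"
    and "u = (2 * k) *\<^sub>R (z - v)"
  have "infnorm u \<le> k" unfolding u_def z_def using \<open>k > 0\<close> by (rule infnorm_lattice_round)
  then obtain r where r: "(z0 + u, r) \<in> C" using lift by blast
  define y where "y = (1 - \<kappa>) *\<^sub>R centroid + \<kappa> *\<^sub>R (z0 + u, r)"
  have "\<kappa> *\<^sub>R u = z - v" using \<kappa>(3) by (simp add: u_def)
  then have "fst y = z" by (simp add: y_def v_def scaleR_add_right)
  moreover have "y \<in> C"
    unfolding y_def using \<kappa> by (intro convexD[OF convex centroid_in r]) auto
  ultimately have "y \<in> S"
    using lattice_round_in[of v] by (cases y) (auto simp: assms(2) z_def)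
  moreover have "ennreal (1 / exp 1 - 3 * (real CARD('n) + real CARD('d)) / (2 * k)) * mixed_integer_volume S
      \<le> mixed_integer_volume (S \<inter> H)" if H: "closed_halfspace H" "y \<in> H" for H
  proof -
    obtain a c where a: "a \<noteq> 0" and Heq: "H = {p. c \<le> a \<bullet> p}"
      using H(1) by (auto simp: closed_halfspace_def)
    have cy: "c \<le> a \<bullet> y" using H(2) by (simp add: Heq)
    have cont: "continuous_on C (\<lambda>p. a \<bullet> p)" by (intro continuous_intros)
    obtain t where t: "t \<in> C" "\<And>p. p \<in> C \<Longrightarrow> a \<bullet> p \<le> a \<bullet> t"
      using continuous_attains_sup[OF compact nonempty cont] by auto
    obtain b where b: "b \<in> C" "\<And>p. p \<in> C \<Longrightarrow> a \<bullet> b \<le> a \<bullet> p"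
      using continuous_attains_inf[OF compact nonempty cont] by auto
    \<comment> \<open>Contraction turns the extra height \<open>\<tau>\<close> into
      \<open>\<kappa> * W\<close>, enough to absorb any mismatch between the points of
      \<open>C\<close> used as contraction centers.\<close>
    define W \<tau> m where "W = a \<bullet> (t - b)" and "\<tau> = \<kappa> * W / (1 - \<kappa>)" and "m = a \<bullet> centroid"
    have W: "0 < W"
      using centroid_less_max[OF a t(2)] b(2)[OF centroid_in] by (simp add: W_def inner_diff_right)
    have \<tau>: "0 \<le> \<tau>" "(1 - \<kappa>) * \<tau> = \<kappa> * W" using W \<kappa> by (simp_all add: \<tau>_def)
    let ?E = "C \<inter> {p. m + \<tau> \<le> a \<bullet> p}"
    have "compact ?E" "compact (C \<inter> H)"
      unfolding Heq by (intro compact_Int_closed compact closed_halfspace_ge)+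
    then have "ennreal ((1 - \<kappa>) ^ N) * emeasure lborel ?E \<le> mixed_integer_volume (C \<inter> H \<inter> (integer_points \<times> UNIV))"
      unfolding \<kappa>_def N_def
    proof (rule mixed_integer_volume_ge[OF _ _ k, of _ _ z0], fold \<kappa>_def)
      fix u :: "real ^ 'n" assume "infnorm u \<le> k"
      then obtain s where s: "(z0 + u, s) \<in> C" using lift by blast
      have "(1 - \<kappa>) *\<^sub>R p + \<kappa> *\<^sub>R (z0 + u, s) \<in> C \<inter> H" if p: "p \<in> ?E" for p
      proof
        show "(1 - \<kappa>) *\<^sub>R p + \<kappa> *\<^sub>R (z0 + u, s) \<in> C"
          using p \<kappa> by (intro convexD[OF convex _ s]) auto
        \<comment> \<open>The worst case: the center used for \<open>y\<close> lies at the top level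
          of \<open>C\<close>, the one used for \<open>p\<close> at the bottom level.\<close>
        have "a \<bullet> y \<le> (1 - \<kappa>) * m + \<kappa> * (a \<bullet> t)"
          unfolding y_def m_def using t(2)[OF r] \<kappa> by (simp only: inner_add_right inner_scaleR_right) simp
        also have "\<dots> = (1 - \<kappa>) * (m + \<tau>) + \<kappa> * (a \<bullet> b)"
          using \<tau>(2) by (simp only: distrib_left W_def inner_diff_right) (simp add: algebra_simps)
        also have "\<dots> \<le> (1 - \<kappa>) * (a \<bullet> p) + \<kappa> * (a \<bullet> (z0 + u, s))"
          using p \<kappa> b(2)[OF s] by (intro add_mono mult_left_mono) auto
        also have "\<dots> = a \<bullet> ((1 - \<kappa>) *\<^sub>R p + \<kappa> *\<^sub>R (z0 + u, s))"
          by (simp only: inner_add_right inner_scaleR_right)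
        finally show "(1 - \<kappa>) *\<^sub>R p + \<kappa> *\<^sub>R (z0 + u, s) \<in> H" using cy by (simp add: Heq)
      qed
      then show "\<exists>s. \<forall>p\<in>?E. (1 - \<kappa>) *\<^sub>R p + \<kappa> *\<^sub>R (z0 + u, s) \<in> C \<inter> H" by blast
    qed
    then have lower: "ennreal ((1 - \<kappa>) ^ N * upper a (m + \<tau>)) \<le> mixed_integer_volume (S \<inter> H)"
      using \<kappa> by (simp add: upper_ennreal[symmetric] ennreal_mult assms(2) Int_ac)
    \<comment> \<open>Gruenbaum's bound at level \<open>m\<close>, minus the slab up to
      \<open>m + \<tau>\<close>, whose width relative to \<open>W\<close> is
      \<open>\<kappa> / (1 - \<kappa>)\<close>.\<close>
    have loss: "volume * (1 / exp 1 - 2 * (real N * \<kappa>) / (1 - \<kappa>)) \<le> upper a (m + \<tau>)"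
    proof -
      have "(upper a m - upper a (m + \<tau>)) * W \<le> 2 * real N * \<tau> * volume"
        using slab[OF a t(1) b(1) \<tau>(1), of m] by (simp add: W_def N_def)
      also have "\<dots> = (2 * (real N * \<kappa>) / (1 - \<kappa>) * volume) * W" by (simp add: \<tau>_def)
      finally have "upper a m - upper a (m + \<tau>) \<le> 2 * (real N * \<kappa>) / (1 - \<kappa>) * volume"
        using W by (rule mult_right_le_imp_le)
      moreover have "volume / exp 1 \<le> upper a m" unfolding m_def by (rule gruenbaum[OF a])
      ultimately show ?thesis by (simp add: algebra_simps)
    qed
    let ?\<epsilon> = "1 / exp 1 - 3 * (real N * \<kappa>)"
    have "ennreal ?\<epsilon> * mixed_integer_volume S \<le> ennreal ?\<epsilon> * (ennreal ((1 + \<kappa>) ^ N) * emeasure lborel C)"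
      using mixed_integer_volume_le[OF compact convex \<open>k > 0\<close> lift]
      by (intro mult_left_mono) (auto simp: assms(2) N_def \<kappa>_def)
    \<comment> \<open>The bound \<open>small\<close> makes the factor nonnegative, so
      \<open>ennreal\<close> is multiplicative here.\<close>
    also have "\<dots> = ennreal (?\<epsilon> * (1 + \<kappa>) ^ N * volume)"
      using small \<kappa> emeasure_fin by (simp add: emeasure_eq_ennreal_measure ennreal_mult mult.assoc)
    also have "\<dots> \<le> ennreal ((1 - \<kappa>) ^ N * upper a (m + \<tau>))"
    proof (rule ennreal_leI)
      have "?\<epsilon> * (1 + \<kappa>) ^ N * volume \<le> (1 - \<kappa>) ^ N * (1 / exp 1 - 2 * (real N * \<kappa>) / (1 - \<kappa>)) * volume"
        using rounding_loss[OF \<kappa>(1,2) N small] volume_pos by (intro mult_right_mono) auto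
      also have "\<dots> = (1 - \<kappa>) ^ N * (volume * (1 / exp 1 - 2 * (real N * \<kappa>) / (1 - \<kappa>)))" by simp
      also have "\<dots> \<le> (1 - \<kappa>) ^ N * upper a (m + \<tau>)"
        using loss \<kappa> by (intro mult_left_mono) auto
      finally show "?\<epsilon> * (1 + \<kappa>) ^ N * volume \<le> (1 - \<kappa>) ^ N * upper a (m + \<tau>)" .
    qed
    also note lower
    finally show ?thesis by (simp add: N_def \<kappa>_def)
  qed
  ultimately show ?thesis by blast
qed

end
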